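(* There is a universal constant $c>0$ such that the following holds for all $n\ge1$. Let $f:\{0,1\}^n\times\{0,1\}^n\to\{0,1\}$ be injective for Bob. Assume that Alice and Bob perform a perfect attack on the one-qubit position-verification protocol associated with $f$, where they communicate only classical information, using a pre-shared entangled pure state on $q_A$ qubits held by Alice and $q_B$ qubits held by Bob. Then the dimension of the pre-shared state is at least linear in $n$: $2^{q_A+q_B}\ge c\,n$.
   Context: $f$ is injective for Bob if for every two different $y,y'\in\{0,1\}^n$ there exists $x$ with $f(x,y)\neq f(x,y')$. Attack on the one-qubit protocol for $f$: the verifiers prepare an EPR pair $\frac{1}{\sqrt2}(\ket{00}+\ket{11})$ on a reference qubit $R$ (kept by the verifiers) and a qubit given to Alice. Alice also receives $x\in\{0,1\}^n$, and Bob receives $y\in\{0,1\}^n$. Alice and Bob pre-share a pure state, independent of $x,y$, on $q_A+q_B$ qubits. First, Alice performs a quantum operation (measurement) depending on $x$ on her qubits, with classical outcome $s$, and Bob performs a quantum operation (measurement) depending on $y$ on his qubits, with classical outcome $t$. Then in a single round of simultaneous classical communication they exchange classical messages (based on $x,s$ and $y,t$ respectively). Finally each performs a local quantum operation depending on all the classical information available to them. The attack is perfect if for all $x,y$, with probability $1$, at the end a qubit held by Alice (if $f(x,y)=0$), respectively by Bob (if $f(x,y)=1$), is exactly in the EPR state $\frac1{\sqrt2}(\ket{00}+\ket{11})$ with $R$. *)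

theory Defs
  imports "Jordan_Normal_Form.Schur_Decomposition"
begin

section \<open>Finite-dimensional quantum systems\<close>

text \<open>
  A system with state space \<open>\<complex>\<^sup>d\<close> is described by complex matrices of dimension d.  In a
  composite system the basis state \<open>|i\<rangle>|k\<rangle>\<close> of \<open>\<complex>\<^sup>a \<otimes> \<complex>\<^sup>b\<close> has index \<open>i * b + k\<close>, so that tensor
  products are associative on the nose.
\<close>

definition kron_mat :: "complex mat \<Rightarrow> complex mat \<Rightarrow> complex mat" (infixr "\<otimes>\<^sub>m" 72) where
  "A \<otimes>\<^sub>m B = mat (dim_row A * dim_row B) (dim_col A * dim_col B)
     (\<lambda>(i, j). A $$ (i div dim_row B, j div dim_col B) * B $$ (i mod dim_row B, j mod dim_col B))"

definition kron_vec :: "complex vec \<Rightarrow> complex vec \<Rightarrow> complex vec" (infixr "\<otimes>\<^sub>v" 72) where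
  "u \<otimes>\<^sub>v v = vec (dim_vec u * dim_vec v) (\<lambda>i. u $ (i div dim_vec v) * v $ (i mod dim_vec v))"

definition unit_vector :: "nat \<Rightarrow> complex vec \<Rightarrow> bool" where
  "unit_vector d v \<longleftrightarrow> v \<in> carrier_vec d \<and> v \<bullet>c v = 1"

definition pure_density :: "complex vec \<Rightarrow> complex mat" where
  "pure_density v = mat (dim_vec v) (dim_vec v) (\<lambda>(i, j). v $ i * cnj (v $ j))"

definition mat_trace :: "complex mat \<Rightarrow> complex" where
  "mat_trace A = (\<Sum>i<dim_row A. A $$ (i, i))"

text \<open>Traces out the middle factor of \<open>\<complex>\<^sup>a \<otimes> \<complex>\<^sup>b \<otimes> \<complex>\<^sup>c\<close>; the last factor of \<open>\<complex>\<^sup>a \<otimes> \<complex>\<^sup>b\<close> is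
  traced out by taking \<open>c = 1\<close>.\<close>

definition partial_trace :: "nat \<Rightarrow> nat \<Rightarrow> nat \<Rightarrow> complex mat \<Rightarrow> complex mat" where
  "partial_trace a b c \<rho> = mat (a * c) (a * c) (\<lambda>(i, j).
     \<Sum>k<b. \<rho> $$ ((i div c * b + k) * c + i mod c, (j div c * b + k) * c + j mod c))"

definition mats_sum :: "nat \<Rightarrow> nat \<Rightarrow> complex mat list \<Rightarrow> complex mat" where
  "mats_sum r c Ms = foldr (+) Ms (0\<^sub>m r c)"

text \<open>A quantum operation is given by a finite list of Kraus operators.\<close>

definition kraus_complete :: "nat \<Rightarrow> nat \<Rightarrow> complex mat list \<Rightarrow> bool" where
  "kraus_complete d_in d_out Ks \<longleftrightarrow> set Ks \<subseteq> carrier_mat d_out d_in \<and>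
     mats_sum d_in d_in (map (\<lambda>K. mat_adjoint K * K) Ks) = 1\<^sub>m d_in"

definition kraus_apply :: "nat \<Rightarrow> complex mat list \<Rightarrow> complex mat \<Rightarrow> complex mat" where
  "kraus_apply d_out Ks \<rho> = mats_sum d_out d_out (map (\<lambda>K. K * \<rho> * mat_adjoint K) Ks)"

text \<open>
  A quantum operation with classical outcome (a quantum instrument) is a list of Kraus lists: the
  outcomes are the positions \<open>s < length I\<close>, and \<open>I ! s\<close> are the Kraus operators of the
  trace-non-increasing operation belonging to outcome s.
\<close>

definition instrument :: "nat \<Rightarrow> nat \<Rightarrow> complex mat list list \<Rightarrow> bool" where
  "instrument d_in d_out I \<longleftrightarrow> kraus_complete d_in d_out (concat I)"

definition epr :: "complex vec" where
  "epr = vec_of_list [1 / of_real (sqrt 2), 0, 0, 1 / of_real (sqrt 2)]"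


section \<open>Attacks with classical communication\<close>

definition bitstrings :: "nat \<Rightarrow> bool list set" where
  "bitstrings n = {x. length x = n}"

definition injective_for_Bob :: "nat \<Rightarrow> (bool list \<Rightarrow> bool list \<Rightarrow> bool) \<Rightarrow> bool" where
  "injective_for_Bob n f \<longleftrightarrow>
     (\<forall>y\<in>bitstrings n. \<forall>y'\<in>bitstrings n. y \<noteq> y' \<longrightarrow> (\<exists>x\<in>bitstrings n. f x y \<noteq> f x y'))"

text \<open>
  Before the measurements the global system is \<open>R \<otimes> (Q \<otimes> A) \<otimes> B\<close>, with R the verifiers' reference
  qubit, Q the qubit sent to Alice, and A and B the registers of the pre-shared state.  The
  measurements of Alice (on \<open>Q \<otimes> A\<close>) and of Bob (on B) leave systems of dimensions \<open>dimA\<close> and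
  \<open>dimB\<close>, which are arbitrary; since there are finitely many inputs and outcomes, it is no
  restriction that they do not depend on these.

  The message of Alice is a function of \<open>(x, s)\<close>, that of Bob of \<open>(y, t)\<close>; randomised messages are
  covered because s and t may contain additional randomness.  Knowing \<open>(x, s)\<close> (hence her own
  message) and Bob's message, Alice performs a final operation whose output is a qubit (first
  factor) together with a remaining system of arbitrary dimension \<open>restA\<close>; similarly for Bob.
\<close>

record attack =
  qA :: nat
  qB :: nat
  shared :: "complex vec"
  dimA :: nat
  dimB :: nat
  measA :: "bool list \<Rightarrow> complex mat list list"
  measB :: "bool list \<Rightarrow> complex mat list list"
  msgA :: "bool list \<Rightarrow> nat \<Rightarrow> bool list"
  msgB :: "bool list \<Rightarrow> nat \<Rightarrow> bool list"
  restA :: nat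
  restB :: nat
  finalA :: "bool list \<Rightarrow> nat \<Rightarrow> bool list \<Rightarrow> complex mat list"
  finalB :: "bool list \<Rightarrow> nat \<Rightarrow> bool list \<Rightarrow> complex mat list"

definition outcomes :: "attack \<Rightarrow> bool list \<Rightarrow> bool list \<Rightarrow> (nat \<times> nat) set" where
  "outcomes P x y = {..<length (measA P x)} \<times> {..<length (measB P y)}"

definition valid_attack :: "nat \<Rightarrow> attack \<Rightarrow> bool" where
  "valid_attack n P \<longleftrightarrow>
     unit_vector (2 ^ qA P * 2 ^ qB P) (shared P) \<and>
     (\<forall>x\<in>bitstrings n. instrument (2 * 2 ^ qA P) (dimA P) (measA P x)) \<and>
     (\<forall>y\<in>bitstrings n. instrument (2 ^ qB P) (dimB P) (measB P y)) \<and>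
     (\<forall>x\<in>bitstrings n. \<forall>y\<in>bitstrings n. \<forall>(s, t)\<in>outcomes P x y.
        kraus_complete (dimA P) (2 * restA P) (finalA P x s (msgB P y t)) \<and>
        kraus_complete (dimB P) (2 * restB P) (finalB P y t (msgA P x s)))"

text \<open>Kraus operators, on R and the two parties' systems, of a pair of local operations.\<close>

definition local_ops :: "complex mat list \<Rightarrow> complex mat list \<Rightarrow> complex mat list" where
  "local_ops Ks Ls = [1\<^sub>m 2 \<otimes>\<^sub>m K \<otimes>\<^sub>m L. K \<leftarrow> Ks, L \<leftarrow> Ls]"

definition initial_state :: "attack \<Rightarrow> complex mat" where
  "initial_state P = pure_density (epr \<otimes>\<^sub>v shared P)"

text \<open>The state after the measurements with outcomes s and t, not normalised: its trace is the
  probability of these outcomes.\<close>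

definition measured_state ::
    "attack \<Rightarrow> bool list \<Rightarrow> bool list \<Rightarrow> nat \<Rightarrow> nat \<Rightarrow> complex mat" where
  "measured_state P x y s t =
     kraus_apply (2 * (dimA P * dimB P)) (local_ops (measA P x ! s) (measB P y ! t)) (initial_state P)"

definition outcome_prob :: "attack \<Rightarrow> bool list \<Rightarrow> bool list \<Rightarrow> nat \<Rightarrow> nat \<Rightarrow> real" where
  "outcome_prob P x y s t = Re (mat_trace (measured_state P x y s t))"

definition post_measurement_state ::
    "attack \<Rightarrow> bool list \<Rightarrow> bool list \<Rightarrow> nat \<Rightarrow> nat \<Rightarrow> complex mat" where
  "post_measurement_state P x y s t =
     complex_of_real (1 / outcome_prob P x y s t) \<cdot>\<^sub>m measured_state P x y s t"

definition final_state ::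
    "attack \<Rightarrow> bool list \<Rightarrow> bool list \<Rightarrow> nat \<Rightarrow> nat \<Rightarrow> complex mat" where
  "final_state P x y s t =
     kraus_apply (2 * ((2 * restA P) * (2 * restB P)))
       (local_ops (finalA P x s (msgB P y t)) (finalB P y t (msgA P x s)))
       (post_measurement_state P x y s t)"

text \<open>Reduced states on R and the output qubit of Alice, respectively Bob.\<close>

definition reduced_Alice :: "attack \<Rightarrow> complex mat \<Rightarrow> complex mat" where
  "reduced_Alice P \<rho> = partial_trace 4 (restA P * (2 * restB P)) 1 \<rho>"

definition reduced_Bob :: "attack \<Rightarrow> complex mat \<Rightarrow> complex mat" where
  "reduced_Bob P \<rho> = partial_trace 4 (restB P) 1 (partial_trace 2 (2 * restA P) (2 * restB P) \<rho>)"

text \<open>The Boolean value False stands for 0 and True for 1.  Since there are finitely many outcomes,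
  success with probability 1 is success for every outcome of positive probability.\<close>

definition perfect_attack :: "nat \<Rightarrow> (bool list \<Rightarrow> bool list \<Rightarrow> bool) \<Rightarrow> attack \<Rightarrow> bool" where
  "perfect_attack n f P \<longleftrightarrow>
     (\<forall>x\<in>bitstrings n. \<forall>y\<in>bitstrings n. \<forall>(s, t)\<in>outcomes P x y. outcome_prob P x y s t > 0 \<longrightarrow>
        (if f x y then reduced_Bob P (final_state P x y s t)
         else reduced_Alice P (final_state P x y s t)) = pure_density epr)"

end

theory Submission
  imports Defs
begin

text \<open>
  For every y pick a Kraus operator L of Bob's measurement with \<open>(1 \<otimes> L)\<psi> \<noteq> 0\<close>, and replace L by a
  square matrix C with \<open>C\<^sup>* C = L\<^sup>* L\<close>; this does not change Alice's reduced state.  The normalised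
  vector \<open>\<phi> y\<close> proportional to \<open>(1 \<otimes> C)\<psi>\<close> lives in dimension \<open>2 ^ (qA + qB)\<close>.
  Suppose \<open>f x y = 0\<close> and \<open>f x y' = 1\<close>, and consider any Kraus operator of Alice's measurement on x.
  For y, Alice's decoder tells the two values of the reference qubit apart perfectly, using her
  side only.  For y', Bob recovers the EPR pair, so that Alice's reduced state is
  independent of the reference qubit.  Comparing the two outputs of one and the same decoder of
  Alice gives \<open>\<parallel>\<phi> y - \<phi> y'\<parallel>\<^sup>2 \<ge> 1/8\<close>.  So injectivity yields \<open>2 ^ n\<close> separated unit
  vectors, whose number is at most exponential in the dimension.
\<close>

section \<open>Packing of separated unit vectors\<close>

lemma sum_lessThan_mult:
  fixes f :: "nat \<Rightarrow> 'a::comm_monoid_add"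
  shows "(\<Sum>i<a*b. f i) = (\<Sum>i<a. \<Sum>j<b. f (i*b+j))"
proof (induction a)
  case (Suc a)
  have *: "(\<Sum>i<m+b. f i) = (\<Sum>i<m. f i) + (\<Sum>j<b. f (m+j))" for m b
    by (induction b) (simp_all add: add.assoc)
  have "(\<Sum>i<Suc a * b. f i) = (\<Sum>i<a*b+b. f i)" by (simp add: add.commute)
  also have "\<dots> = (\<Sum>i<a*b. f i) + (\<Sum>j<b. f (a*b+j))"
    using *[of "a*b" b] .
  finally show ?case using Suc by simp
qed simp

lemma sum_less_two: "(\<Sum>i<2::nat. f i) = f 0 + f 1"
  by (simp add: numeral_2_eq_2)

text \<open>By induction on the length: a head of absolute value k, with two possible signs, leaves
  budget \<open>R - k\<close> for the tail. As 2 times the sum of the \<open>2 ^ (R - k)\<close> is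
  at most \<open>2 ^ (R + 2)\<close>, each entry costs a factor 4.\<close>

lemma card_int_lists_le:
  "finite {ks::int list. length ks = N \<and> (\<Sum>k\<leftarrow>ks. nat \<bar>k\<bar>) \<le> R} \<and>
   card {ks::int list. length ks = N \<and> (\<Sum>k\<leftarrow>ks. nat \<bar>k\<bar>) \<le> R} \<le> 2 ^ (R + 2 * N)"
proof (induction N arbitrary: R)
  case 0
  have "{ks::int list. length ks = 0 \<and> (\<Sum>k\<leftarrow>ks. nat \<bar>k\<bar>) \<le> R} = {[]}" by auto
  then show ?case by simp
next
  case (Suc N)
  define S where "S = (\<lambda>R. {ks::int list. length ks = N \<and> (\<Sum>k\<leftarrow>ks. nat \<bar>k\<bar>) \<le> R})"
  \<comment> \<open>Lists are cut into sign, absolute value and tail. A head 0 arises from both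
    signs, which only overcounts.\<close>
  define U where "U = (\<Union>p\<in>UNIV \<times> {..R}. (#) (if fst p then int (snd p) else - int (snd p)) ` S (R - snd p))"
  have fin: "finite (S r)" and le: "card (S r) \<le> 2 ^ (r + 2 * N)" for r
    using Suc[of r] by (auto simp: S_def)
  have "{ks::int list. length ks = Suc N \<and> (\<Sum>k\<leftarrow>ks. nat \<bar>k\<bar>) \<le> R} \<subseteq> U"
  proof
    fix ks :: "int list"
    assume "ks \<in> {ks. length ks = Suc N \<and> (\<Sum>k\<leftarrow>ks. nat \<bar>k\<bar>) \<le> R}"
    then obtain k ls where ks: "ks = k # ls" and "length ls = N" "nat \<bar>k\<bar> + (\<Sum>k\<leftarrow>ls. nat \<bar>k\<bar>) \<le> R"
      by (auto simp: length_Suc_conv)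
    then have "ls \<in> S (R - nat \<bar>k\<bar>)" "nat \<bar>k\<bar> \<le> R" by (auto simp: S_def)
    then show "ks \<in> U"
      unfolding U_def ks by (intro UN_I[of "(k \<ge> 0, nat \<bar>k\<bar>)"]) auto
  qed
  moreover have "finite U" unfolding U_def by (auto simp: fin)
  moreover have "card U \<le> 2 ^ (R + 2 * Suc N)"
  proof -
    have "card U \<le> (\<Sum>p\<in>(UNIV::bool set) \<times> {..R}. card ((#) (if fst p then int (snd p) else - int (snd p)) ` S (R - snd p)))"
      unfolding U_def by (rule card_UN_le) simp
    also have "\<dots> \<le> (\<Sum>(b, k)\<in>(UNIV::bool set) \<times> {..R}. 2 ^ (R - k + 2 * N))"
      unfolding split_def by (intro sum_mono order_trans[OF card_image_le le] fin)
    also have "\<dots> = 2 * (\<Sum>k\<le>R. 2 ^ (R - k + 2 * N))"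
      by (simp add: UNIV_bool flip: sum.cartesian_product)
    also have "(\<Sum>k\<le>R. 2 ^ (R - k + 2 * N)) = (\<Sum>k\<le>R. 2 ^ (R - k)) * (2::nat) ^ (2 * N)"
      by (simp add: sum_distrib_right del: Nat.add_diff_assoc2 flip: power_add)
    also have "(\<Sum>k\<le>R. (2::nat) ^ (R - k)) \<le> 2 ^ (R + 1)"
    proof (induction R)
      case (Suc R)
      then show ?case by (subst sum.atMost_Suc_shift) simp
    qed simp
    finally show ?thesis by (simp add: power_add)
  qed
  ultimately show ?case by (meson card_mono finite_subset order_trans)
qed

text \<open>Scale by T and round every coordinate down. Vectors with the same rounding differ by at
  most \<open>1 / T\<close> per coordinate, which is too close. The bound
  \<open>2 * t \<le> t\<^sup>2 + 1\<close> turns unit length into an absolute sum of at most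
  \<open>10 * M\<close> for the rounded vector, so \<open>card_int_lists_le\<close> counts the
  roundings.\<close>

lemma card_separated_real_le:
  fixes v :: "'a \<Rightarrow> nat \<Rightarrow> real"
  assumes unit: "\<And>y. y \<in> Y \<Longrightarrow> (\<Sum>i<M. (v y i)\<^sup>2) = 1"
    and sep: "\<And>y y'. y \<in> Y \<Longrightarrow> y' \<in> Y \<Longrightarrow> y \<noteq> y' \<Longrightarrow> (\<Sum>i<M. (v y i - v y' i)\<^sup>2) \<ge> 1 / 8"
  shows "card Y \<le> 2 ^ (12 * M)"
proof (cases "M = 0")
  case True
  then have "Y = {}" using unit by fastforce
  then show ?thesis by simp
next
  case False
  \<comment> \<open>With \<open>T\<^sup>2 = 16 * M\<close>, a common rounding cell has squared
    diameter at most 1/16, below the separation 1/8, while the entries still sum to O(M).\<close>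
  define T where "T = 4 * sqrt (real M)"
  have T2: "T\<^sup>2 = 16 * real M" by (simp add: T_def power_mult_distrib)
  have T0: "T > 0" using False by (simp add: T_def)
  define g where "g = (\<lambda>y. map (\<lambda>i. \<lfloor>T * v y i\<rfloor>) [0..<M])"
  define S where "S = {ks::int list. length ks = M \<and> (\<Sum>k\<leftarrow>ks. nat \<bar>k\<bar>) \<le> 10 * M}"
  have "inj_on g Y"
  proof (rule inj_onI, rule ccontr)
    fix y y' assume y: "y \<in> Y" "y' \<in> Y" and g: "g y = g y'" and "y \<noteq> y'"
    have "(v y i - v y' i)\<^sup>2 \<le> 1 / T\<^sup>2" if "i < M" for i
    proof -
      have "\<lfloor>T * v y i\<rfloor> = \<lfloor>T * v y' i\<rfloor>" using g that by (simp add: g_def)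
      then have "\<bar>T * v y i - T * v y' i\<bar> \<le> 1" by linarith
      then have "T\<^sup>2 * (v y i - v y' i)\<^sup>2 \<le> 1"
        by (simp add: abs_square_le_1 right_diff_distrib flip: power_mult_distrib)
      then show ?thesis using T0 by (simp add: field_simps)
    qed
    then have "(\<Sum>i<M. (v y i - v y' i)\<^sup>2) \<le> (\<Sum>i<M. 1 / T\<^sup>2)" by (intro sum_mono) auto
    also have "\<dots> = 1 / 16" using False by (simp add: T2)
    finally show False using sep[OF y \<open>y \<noteq> y'\<close>] by simp
  qed
  moreover have "g ` Y \<subseteq> S"
  proof
    fix ks assume "ks \<in> g ` Y"
    then obtain y where y: "y \<in> Y" and ks: "ks = g y" by auto
    have *: "real (nat \<bar>\<lfloor>T * v y i\<rfloor>\<bar>) \<le> 8 * real M * (v y i)\<^sup>2 + 3 / 2" for i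
    proof -
      have "real (nat \<bar>\<lfloor>T * v y i\<rfloor>\<bar>) \<le> \<bar>T * v y i\<bar> + 1" by linarith
      moreover have "2 * \<bar>T * v y i\<bar> \<le> \<bar>T * v y i\<bar>\<^sup>2 + 1"
        using sum_squares_bound[of "\<bar>T * v y i\<bar>" 1] by simp
      ultimately show ?thesis by (simp add: power_mult_distrib T2)
    qed
    have "real (\<Sum>i<M. nat \<bar>\<lfloor>T * v y i\<rfloor>\<bar>) \<le> (\<Sum>i<M. 8 * real M * (v y i)\<^sup>2 + 3 / 2)"
      unfolding of_nat_sum by (intro sum_mono *)
    also have "\<dots> = 8 * real M + 3 / 2 * real M"
      by (simp add: sum.distrib unit[OF y] flip: sum_distrib_left)
    finally have "(\<Sum>i<M. nat \<bar>\<lfloor>T * v y i\<rfloor>\<bar>) \<le> 10 * M" by linarith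
    then show "ks \<in> S"
      by (simp add: S_def ks g_def o_def interv_sum_list_conv_sum_set_nat lessThan_atLeast0)
  qed
  ultimately have "card Y \<le> card S"
    using card_inj_on_le card_int_lists_le S_def by blast
  also have "\<dots> \<le> 2 ^ (12 * M)" using card_int_lists_le[of M "10 * M"] by (simp add: S_def)
  finally show ?thesis .
qed

lemma card_separated_complex_le:
  fixes v :: "'a \<Rightarrow> nat \<Rightarrow> complex"
  assumes unit: "\<And>y. y \<in> Y \<Longrightarrow> (\<Sum>i<M. (cmod (v y i))\<^sup>2) = 1"
    and sep: "\<And>y y'. y \<in> Y \<Longrightarrow> y' \<in> Y \<Longrightarrow> y \<noteq> y' \<Longrightarrow> (\<Sum>i<M. (cmod (v y i - v y' i))\<^sup>2) \<ge> 1 / 8"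
  shows "card Y \<le> 2 ^ (24 * M)"
proof -
  \<comment> \<open>Real parts followed by imaginary parts: an isometry onto twice as many real
    coordinates.\<close>
  define w where "w = (\<lambda>y i. if i < M then Re (v y i) else Im (v y (i - M)))"
  have "(\<Sum>i<2*M. (w y i)\<^sup>2) = (\<Sum>i<M. (cmod (v y i))\<^sup>2)" for y
    unfolding sum_lessThan_mult by (simp add: sum_less_two w_def cmod_power2 sum.distrib)
  moreover have "(\<Sum>i<2*M. (w y i - w y' i)\<^sup>2) = (\<Sum>i<M. (cmod (v y i - v y' i))\<^sup>2)" for y y'
    unfolding sum_lessThan_mult by (simp add: sum_less_two w_def cmod_power2 sum.distrib)
  ultimately have "card Y \<le> 2 ^ (12 * (2 * M))"
    using unit sep by (intro card_separated_real_le[where v = w]) auto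
  then show ?thesis by simp
qed

section \<open>Gram matrices\<close>

lemma mult_cnj_self: "z * cnj z = of_real ((cmod z)\<^sup>2)"
  by (simp only: complex_norm_square)

lemma sum_mult_cnj_sum:
  fixes a b :: "'i \<Rightarrow> complex"
  shows "(\<Sum>i\<in>I. a i) * cnj (\<Sum>i\<in>J. b i) = (\<Sum>i\<in>I. \<Sum>i'\<in>J. a i * cnj (b i'))"
  by (simp add: sum_product)

lemma norm_sq_linear_comb:
  fixes a :: "'i \<Rightarrow> 'j \<Rightarrow> complex"
  shows "of_real (\<Sum>j\<in>J. (cmod (\<Sum>i\<in>I. c i * a i j))\<^sup>2) =
    (\<Sum>i\<in>I. \<Sum>i'\<in>I. c i * cnj (c i') * (\<Sum>j\<in>J. a i j * cnj (a i' j)))"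
proof -
  have "of_real (\<Sum>j\<in>J. (cmod (\<Sum>i\<in>I. c i * a i j))\<^sup>2) =
      (\<Sum>j\<in>J. (\<Sum>i\<in>I. c i * a i j) * cnj (\<Sum>i\<in>I. c i * a i j))"
    unfolding mult_cnj_self by simp
  also have "\<dots> = (\<Sum>j\<in>J. \<Sum>i\<in>I. \<Sum>i'\<in>I. c i * cnj (c i') * (a i j * cnj (a i' j)))"
    unfolding sum_mult_cnj_sum by (simp add: mult_ac)
  also have "\<dots> = (\<Sum>i\<in>I. \<Sum>i'\<in>I. \<Sum>j\<in>J. c i * cnj (c i') * (a i j * cnj (a i' j)))"
    by (subst sum.swap) (intro sum.cong refl sum.swap)
  finally show ?thesis by (simp add: sum_distrib_left)
qed

text \<open>The norm of a combination is a quadratic form in the Gram matrix, so vectors with equal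
  Gram matrices are interchangeable, even when they live in spaces of different dimension.\<close>

lemma norm_sq_linear_comb_cong:
  fixes a :: "'i \<Rightarrow> 'j \<Rightarrow> complex" and b :: "'i \<Rightarrow> 'k \<Rightarrow> complex"
  assumes "\<And>i i'. i \<in> I \<Longrightarrow> i' \<in> I \<Longrightarrow>
    (\<Sum>j\<in>J. a i j * cnj (a i' j)) = (\<Sum>k\<in>K. b i k * cnj (b i' k))"
  shows "(\<Sum>j\<in>J. (cmod (\<Sum>i\<in>I. c i * a i j))\<^sup>2) = (\<Sum>k\<in>K. (cmod (\<Sum>i\<in>I. c i * b i k))\<^sup>2)"
proof -
  have "complex_of_real (\<Sum>j\<in>J. (cmod (\<Sum>i\<in>I. c i * a i j))\<^sup>2) =
      of_real (\<Sum>k\<in>K. (cmod (\<Sum>i\<in>I. c i * b i k))\<^sup>2)"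
    unfolding norm_sq_linear_comb by (intro sum.cong refl) (simp add: assms)
  then show ?thesis by (simp only: of_real_eq_iff)
qed

lemma cmod_add_sq_le: "(cmod (x + y))\<^sup>2 \<le> 2 * (cmod x)\<^sup>2 + 2 * (cmod y)\<^sup>2"
proof -
  have "(cmod (x + y))\<^sup>2 \<le> (cmod x + cmod y)\<^sup>2"
    by (intro power_mono norm_triangle_ineq) simp
  also have "\<dots> \<le> 2 * (cmod x)\<^sup>2 + 2 * (cmod y)\<^sup>2"
    using sum_squares_bound[of "cmod x" "cmod y"] by (simp add: power2_sum)
  finally show ?thesis .
qed

text \<open>Gram-Schmidt in which a column depending linearly on its predecessors contributes the zero
  vector \<open>u k\<close>, flagged by \<open>\<not> e k\<close>.\<close>

lemma gram_schmidt_expansion: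
  fixes L :: "nat \<Rightarrow> nat \<Rightarrow> complex"
  shows "\<exists>(u :: nat \<Rightarrow> nat \<Rightarrow> complex) e C.
    (\<forall>k<d. \<forall>k'<d. (\<Sum>j<m. u k j * cnj (u k' j)) = (if k = k' \<and> e k then 1 else 0)) \<and>
    (\<forall>k<d. \<forall>b<d. \<not> e k \<longrightarrow> C k b = 0) \<and>
    (\<forall>b<d. \<forall>j<m. L j b = (\<Sum>k<d. C k b * u k j))"
proof (induction d)
  case (Suc d)
  from Suc obtain u :: "nat \<Rightarrow> nat \<Rightarrow> complex" and e C where
    *: "\<forall>k<d. \<forall>k'<d. (\<Sum>j<m. u k j * cnj (u k' j)) = (if k = k' \<and> e k then 1 else 0)"
    "\<forall>k<d. \<forall>b<d. \<not> e k \<longrightarrow> C k b = 0"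
    "\<forall>b<d. \<forall>j<m. L j b = (\<Sum>k<d. C k b * u k j)"
    by (elim exE conjE) (rule that)
  note orth = *(1)[rule_format] and C0 = *(2)[rule_format] and L = *(3)[rule_format]
  define c where "c = (\<lambda>k. \<Sum>j<m. L j d * cnj (u k j))"
  define r where "r = (\<lambda>j. L j d - (\<Sum>k<d. c k * u k j))"
  define nr where "nr = sqrt (\<Sum>j<m. (cmod (r j))\<^sup>2)"
  \<comment> \<open>If the residual r has norm 0, division by zero yields the zero vector, which is
    the value wanted for a dependent column.\<close>
  define u' where "u' = (\<lambda>k j. if k = d then r j / of_real nr else u k j)"
  define e' where "e' = (\<lambda>k. if k = d then nr \<noteq> 0 else e k)"
  define C' where "C' = (\<lambda>k b. if b = d then (if k = d then of_real nr else c k)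
    else if k = d then 0 else C k b)"
  have u0: "u k j = 0" if "k < d" "j < m" "\<not> e k" for k j
  proof -
    have "of_real (\<Sum>j<m. (cmod (u k j))\<^sup>2) = (\<Sum>j<m. u k j * cnj (u k j))"
      by (simp add: mult_cnj_self)
    then have "(\<Sum>j<m. (cmod (u k j))\<^sup>2) = 0"
      using orth[of k k] that by (simp del: of_real_sum)
    then show ?thesis using that by (simp add: sum_nonneg_eq_0_iff)
  qed
  \<comment> \<open>A coefficient against a zero vector vanishes, so the row of C' belonging to a
    flagged k stays zero in the new column as well.\<close>
  have c0: "c k = 0" if "k < d" "\<not> e k" for k
    unfolding c_def by (rule sum.neutral) (simp add: u0 that)
  have r0: "r j = 0" if "nr = 0" "j < m" for j
    using that by (simp add: nr_def sum_nonneg_eq_0_iff)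
  have rr: "(\<Sum>j<m. r j * cnj (r j)) = of_real (nr\<^sup>2)"
    by (simp add: nr_def mult_cnj_self sum_nonneg)
  have ru: "(\<Sum>j<m. r j * cnj (u k j)) = 0" if "k < d" for k
  proof -
    have "(\<Sum>j<m. r j * cnj (u k j)) =
        c k - (\<Sum>j<m. \<Sum>k'<d. c k' * (u k' j * cnj (u k j)))"
      by (simp add: r_def c_def left_diff_distrib sum_subtractf sum_distrib_right mult.assoc)
    also have "(\<Sum>j<m. \<Sum>k'<d. c k' * (u k' j * cnj (u k j))) =
        (\<Sum>k'<d. c k' * (\<Sum>j<m. u k' j * cnj (u k j)))"
      by (subst sum.swap) (simp add: sum_distrib_left)
    also have "\<dots> = (\<Sum>k'<d. if k' = k then c k else 0)"
      by (intro sum.cong refl) (auto simp: orth that c0)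
    also have "\<dots> = c k" using that by simp
    finally show ?thesis by simp
  qed
  have ur: "(\<Sum>j<m. u k j * cnj (r j)) = 0" if "k < d" for k
    using arg_cong[OF ru[OF that], of cnj] by (simp add: mult.commute)
  have "(\<Sum>j<m. u' k j * cnj (u' k' j)) = (if k = k' \<and> e' k then 1 else 0)"
    if "k < Suc d" "k' < Suc d" for k k'
  proof -
    consider "k < d" "k' < d" | "k = d" "k' < d" | "k < d" "k' = d" | "k = d" "k' = d"
      using \<open>k < Suc d\<close> \<open>k' < Suc d\<close> by linarith
    then show ?thesis
    proof cases
      case 1
      then show ?thesis using orth by (simp add: u'_def e'_def)
    next
      case 2
      then show ?thesis using ru[of k'] by (simp add: u'_def flip: sum_divide_distrib)
    next
      case 3
      then show ?thesis using ur[of k] by (simp add: u'_def flip: sum_divide_distrib)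
    next
      case 4
      have "(\<Sum>j<m. u' k j * cnj (u' k' j)) = (\<Sum>j<m. r j * cnj (r j)) / of_real (nr\<^sup>2)"
        using 4 by (simp add: u'_def power2_eq_square sum_divide_distrib)
      then show ?thesis using 4 by (simp add: rr e'_def)
    qed
  qed
  moreover have "C' k b = 0" if "k < Suc d" "b < Suc d" "\<not> e' k" for k b
    using that C0 c0 by (auto simp: C'_def e'_def less_Suc_eq)
  moreover have "L j b = (\<Sum>k<Suc d. C' k b * u' k j)" if "b < Suc d" "j < m" for j b
  proof (cases "b = d")
    case True
    have "(\<Sum>k<Suc d. C' k b * u' k j) = (\<Sum>k<d. c k * u k j) + of_real nr * (r j / of_real nr)"
      using True by (simp add: C'_def u'_def)
    also have "of_real nr * (r j / of_real nr) = r j" using r0 that by simp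
    finally show ?thesis by (simp add: r_def True)
  next
    case False
    then show ?thesis using L[of b j] that by (simp add: C'_def u'_def)
  qed
  ultimately show ?case by blast
qed simp

text \<open>A QR decomposition L = UC: the d columns of U are orthonormal or zero, and zero columns
  meet only zero rows of C, so U drops out of the Gram matrix. The number of rows falls from an
  arbitrary m to d.\<close>

lemma square_matrix_same_gram:
  fixes L :: "nat \<Rightarrow> nat \<Rightarrow> complex"
  obtains C :: "nat \<Rightarrow> nat \<Rightarrow> complex" where
    "\<And>b b'. b < d \<Longrightarrow> b' < d \<Longrightarrow>
      (\<Sum>j<m. L j b * cnj (L j b')) = (\<Sum>k<d. C k b * cnj (C k b'))"
proof -
  from gram_schmidt_expansion[of d m L] obtain u :: "nat \<Rightarrow> nat \<Rightarrow> complex" and e C where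
    *: "\<forall>k<d. \<forall>k'<d. (\<Sum>j<m. u k j * cnj (u k' j)) = (if k = k' \<and> e k then 1 else 0)"
    "\<forall>k<d. \<forall>b<d. \<not> e k \<longrightarrow> C k b = 0"
    "\<forall>b<d. \<forall>j<m. L j b = (\<Sum>k<d. C k b * u k j)"
    by (elim exE conjE) (rule that)
  note orth = *(1)[rule_format] and C0 = *(2)[rule_format] and L = *(3)[rule_format]
  have "(\<Sum>j<m. L j b * cnj (L j b')) = (\<Sum>k<d. C k b * cnj (C k b'))" if b: "b < d" "b' < d" for b b'
  proof -
    have "(\<Sum>j<m. L j b * cnj (L j b')) =
        (\<Sum>j<m. \<Sum>k<d. \<Sum>k'<d. C k b * cnj (C k' b') * (u k j * cnj (u k' j)))"
      using b by (intro sum.cong refl) (simp add: L sum_product mult_ac)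
    also have "\<dots> = (\<Sum>k<d. \<Sum>k'<d. C k b * cnj (C k' b') * (\<Sum>j<m. u k j * cnj (u k' j)))"
      unfolding sum_distrib_left by (subst sum.swap) (intro sum.cong refl sum.swap)
    also have "\<dots> = (\<Sum>k<d. \<Sum>k'<d. if k' = k then C k b * cnj (C k b') else 0)"
      using b by (intro sum.cong refl) (auto simp: orth C0)
    finally show ?thesis by simp
  qed
  then show thesis by (rule that)
qed

section \<open>Kraus operators and ensembles\<close>

lemma mat_adjoint_carrier: "K \<in> carrier_mat a b \<Longrightarrow> mat_adjoint K \<in> carrier_mat b a"
  by (auto simp: mat_adjoint_def)

lemma mat_adjoint_index:
  fixes K :: "complex mat"
  shows "K \<in> carrier_mat a b \<Longrightarrow> i < b \<Longrightarrow> j < a \<Longrightarrow> mat_adjoint K $$ (i, j) = cnj (K $$ (j, i))"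
  by (auto simp: mat_adjoint_def mat_of_rows_index)

lemma mat_mult_index_sum:
  assumes "A \<in> carrier_mat a b" "B \<in> carrier_mat b c" "i < a" "j < c"
  shows "(A * B) $$ (i, j) = (\<Sum>k<b. A $$ (i, k) * B $$ (k, j))"
  using assms by (auto simp: scalar_prod_def lessThan_atLeast0)

lemma mats_sum_index:
  assumes "set Ms \<subseteq> carrier_mat r c"
  shows "mats_sum r c Ms \<in> carrier_mat r c"
    and "i < r \<Longrightarrow> j < c \<Longrightarrow> mats_sum r c Ms $$ (i, j) = (\<Sum>M\<leftarrow>Ms. M $$ (i, j))"
proof -
  have "mats_sum r c Ms \<in> carrier_mat r c \<and>
    (i < r \<longrightarrow> j < c \<longrightarrow> mats_sum r c Ms $$ (i, j) = (\<Sum>M\<leftarrow>Ms. M $$ (i, j)))"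
    using assms unfolding mats_sum_def by (induction Ms) auto
  then show "mats_sum r c Ms \<in> carrier_mat r c"
    and "i < r \<Longrightarrow> j < c \<Longrightarrow> mats_sum r c Ms $$ (i, j) = (\<Sum>M\<leftarrow>Ms. M $$ (i, j))" by auto
qed

lemma sum_list_nth: "(\<Sum>x\<leftarrow>xs. f x) = (\<Sum>n<length xs. f (xs ! n))"
  by (simp add: sum_list_sum_nth lessThan_atLeast0)

text \<open>Stacking the Kraus operators gives one matrix with rows indexed by (operator, row).
  Completeness says that its columns \<open>a j\<close> are orthonormal, so it preserves
  norms.\<close>

lemma kraus_complete_norm:
  assumes "kraus_complete d d' Ks"
  shows "(\<Sum>K\<leftarrow>Ks. \<Sum>i<d'. (cmod (\<Sum>j<d. K $$ (i, j) * z j))\<^sup>2) = (\<Sum>j<d. (cmod (z j))\<^sup>2)"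
proof -
  have K: "set Ks \<subseteq> carrier_mat d' d"
    and 1: "mats_sum d d (map (\<lambda>K. mat_adjoint K * K) Ks) = 1\<^sub>m d"
    using assms by (auto simp: kraus_complete_def)
  let ?J = "{..<length Ks} \<times> {..<d'}"
  define a where "a = (\<lambda>j (n, i). (Ks ! n) $$ (i, j))"
  have delta: "(\<Sum>p\<in>?J. a j p * cnj (a j' p)) = (if j = j' then 1 else 0)"
    if j: "j < d" "j' < d" for j j'
  proof -
    have "(\<Sum>p\<in>?J. a j p * cnj (a j' p)) = (\<Sum>K\<leftarrow>Ks. \<Sum>i<d'. K $$ (i, j) * cnj (K $$ (i, j')))"
      unfolding sum_list_nth a_def by (simp add: sum.cartesian_product case_prod_unfold)
    also have "\<dots> = (\<Sum>K\<leftarrow>Ks. (mat_adjoint K * K) $$ (j', j))"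
    proof (intro arg_cong[where f = sum_list] map_cong refl)
      fix K assume "K \<in> set Ks"
      then have K': "K \<in> carrier_mat d' d" using K by auto
      show "(\<Sum>i<d'. K $$ (i, j) * cnj (K $$ (i, j'))) = (mat_adjoint K * K) $$ (j', j)"
        unfolding mat_mult_index_sum[OF mat_adjoint_carrier[OF K'] K' j(2,1)]
        using j by (intro sum.cong refl) (simp add: mat_adjoint_index[OF K'] mult.commute)
    qed
    also have "\<dots> = mats_sum d d (map (\<lambda>K. mat_adjoint K * K) Ks) $$ (j', j)"
      using K j by (subst mats_sum_index) (auto simp: o_def intro!: mult_carrier_mat mat_adjoint_carrier)
    finally show ?thesis using j by (simp add: 1)
  qed
  have "(\<Sum>K\<leftarrow>Ks. \<Sum>i<d'. (cmod (\<Sum>j<d. K $$ (i, j) * z j))\<^sup>2) =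
      (\<Sum>p\<in>?J. (cmod (\<Sum>j<d. z j * a j p))\<^sup>2)"
    unfolding sum_list_nth a_def by (simp add: sum.cartesian_product case_prod_unfold mult.commute)
  moreover have "complex_of_real (\<Sum>p\<in>?J. (cmod (\<Sum>j<d. z j * a j p))\<^sup>2) =
      of_real (\<Sum>j<d. (cmod (z j))\<^sup>2)"
  proof -
    have "complex_of_real (\<Sum>p\<in>?J. (cmod (\<Sum>j<d. z j * a j p))\<^sup>2) =
        (\<Sum>j<d. \<Sum>j'<d. if j' = j then z j * cnj (z j) else 0)"
      unfolding norm_sq_linear_comb by (intro sum.cong refl) (auto simp: delta)
    then show ?thesis by (simp add: mult_cnj_self)
  qed
  ultimately show ?thesis by (simp only: of_real_eq_iff)
qed

text \<open>An isometry is injective. This is how a party's decoder is later removed from equations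
  that hold for all of its Kraus operators.\<close>

lemma kraus_complete_zero:
  assumes "kraus_complete d d' Ks"
    and "\<And>K i. K \<in> set Ks \<Longrightarrow> i < d' \<Longrightarrow> (\<Sum>j<d. K $$ (i, j) * z j) = 0" and "j < d"
  shows "z j = 0"
proof -
  have "(\<Sum>K\<leftarrow>Ks. \<Sum>i<d'. (cmod (\<Sum>j<d. K $$ (i, j) * z j))\<^sup>2) = 0"
    unfolding sum_list_nth by (simp add: assms(2))
  then show ?thesis
    using assms(3) by (simp add: kraus_complete_norm[OF assms(1)] sum_nonneg_eq_0_iff)
qed

text \<open>An unnormalised mixture; the squared norms of the vectors are the weights.\<close>

definition ensemble :: "nat \<Rightarrow> complex mat \<Rightarrow> complex vec list \<Rightarrow> bool" where
  "ensemble d \<rho> ws \<longleftrightarrow> \<rho> \<in> carrier_mat d d \<and> set ws \<subseteq> carrier_vec d \<and>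
     (\<forall>i<d. \<forall>j<d. \<rho> $$ (i, j) = (\<Sum>w\<leftarrow>ws. w $ i * cnj (w $ j)))"

lemma ensemble_pure_density: "w \<in> carrier_vec d \<Longrightarrow> ensemble d (pure_density w) [w]"
  by (auto simp: ensemble_def pure_density_def)

lemma ensemble_smult:
  assumes "ensemble d \<rho> ws" and "c \<ge> 0"
  shows "ensemble d (of_real c \<cdot>\<^sub>m \<rho>) (map ((\<cdot>\<^sub>v) (of_real (sqrt c))) ws)"
proof -
  have "complex_of_real (sqrt c) * of_real (sqrt c) = of_real c"
    using assms(2) by (simp flip: of_real_mult)
  then have c: "of_real (sqrt c) * x * (of_real (sqrt c) * y) = of_real c * (x * y)" for x y :: complex
    by (metis mult.assoc mult.left_commute)
  have w: "dim_vec (ws ! n) = d" if "n < length ws" for n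
    using assms(1) nth_mem[OF that] by (auto simp: ensemble_def)
  have "(of_real c \<cdot>\<^sub>m \<rho>) $$ (i, j) =
      (\<Sum>w\<leftarrow>map ((\<cdot>\<^sub>v) (of_real (sqrt c))) ws. w $ i * cnj (w $ j))" if ij: "i < d" "j < d" for i j
  proof -
    have "(of_real c \<cdot>\<^sub>m \<rho>) $$ (i, j) = of_real c * (\<Sum>w\<leftarrow>ws. w $ i * cnj (w $ j))"
      using assms(1) ij by (auto simp: ensemble_def)
    also have "\<dots> = (\<Sum>n<length ws. of_real c * ((ws ! n) $ i * cnj ((ws ! n) $ j)))"
      by (simp add: sum_list_nth sum_distrib_left)
    also have "\<dots> = (\<Sum>n<length ws. (of_real (sqrt c) \<cdot>\<^sub>v (ws ! n)) $ i * cnj ((of_real (sqrt c) \<cdot>\<^sub>v (ws ! n)) $ j))"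
      using w ij by (intro sum.cong refl) (simp add: c)
    finally show ?thesis by (simp add: sum_list_nth)
  qed
  then show ?thesis using assms(1) by (auto simp: ensemble_def)
qed

text \<open>Conjugation by K sends the rank-one term of w to that of Kw. Mixed states can thus be
  followed vector by vector, one for each choice of Kraus operators.\<close>

lemma ensemble_kraus_apply:
  assumes "ensemble d \<rho> ws" and K: "set Ks \<subseteq> carrier_mat d' d"
  shows "ensemble d' (kraus_apply d' Ks \<rho>) [K *\<^sub>v w. K \<leftarrow> Ks, w \<leftarrow> ws]"
proof -
  have rho: "\<rho> \<in> carrier_mat d d" and ws: "\<And>w. w \<in> set ws \<Longrightarrow> w \<in> carrier_vec d"
    and rho_eq: "\<And>i j. i < d \<Longrightarrow> j < d \<Longrightarrow> \<rho> $$ (i, j) = (\<Sum>w\<leftarrow>ws. w $ i * cnj (w $ j))"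
    using assms(1) by (auto simp: ensemble_def)
  have car: "K * \<rho> * mat_adjoint K \<in> carrier_mat d' d'" if "K \<in> set Ks" for K
    using that K rho mat_adjoint_carrier by (metis mult_carrier_mat subsetD)
  have entry: "(K * \<rho> * mat_adjoint K) $$ (i, j) = (\<Sum>w\<leftarrow>ws. (K *\<^sub>v w) $ i * cnj ((K *\<^sub>v w) $ j))"
    if "K \<in> set Ks" and ij: "i < d'" "j < d'" for K i j
  proof -
    have K': "K \<in> carrier_mat d' d" using that K by auto
    have "(K * \<rho> * mat_adjoint K) $$ (i, j) =
        (\<Sum>b<d. (\<Sum>a<d. K $$ (i, a) * \<rho> $$ (a, b)) * cnj (K $$ (j, b)))"
      unfolding mat_mult_index_sum[OF mult_carrier_mat[OF K' rho] mat_adjoint_carrier[OF K'] ij]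
      by (intro sum.cong refl) (simp add: mat_mult_index_sum[OF K' rho ij(1)] mat_adjoint_index[OF K' _ ij(2)])
    also have "\<dots> = (\<Sum>b<d. \<Sum>a<d. \<Sum>n<length ws.
        K $$ (i, a) * (ws ! n) $ a * cnj (K $$ (j, b) * (ws ! n) $ b))"
      by (simp add: rho_eq sum_list_nth sum_distrib_left sum_distrib_right mult_ac)
    also have "\<dots> = (\<Sum>n<length ws. \<Sum>b<d. \<Sum>a<d.
        K $$ (i, a) * (ws ! n) $ a * cnj (K $$ (j, b) * (ws ! n) $ b))"
      by (subst sum.swap[of _ "{..<length ws}"]) (intro sum.cong refl sum.swap)
    also have "\<dots> = (\<Sum>n<length ws. \<Sum>a<d. \<Sum>b<d.
        K $$ (i, a) * (ws ! n) $ a * cnj (K $$ (j, b) * (ws ! n) $ b))"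
      by (intro sum.cong refl sum.swap)
    also have "\<dots> = (\<Sum>n<length ws. (K *\<^sub>v (ws ! n)) $ i * cnj ((K *\<^sub>v (ws ! n)) $ j))"
    proof (intro sum.cong refl)
      fix n assume "n \<in> {..<length ws}"
      then have w: "dim_vec (ws ! n) = d" using ws by (metis carrier_vecD lessThan_iff nth_mem)
      show "(\<Sum>a<d. \<Sum>b<d. K $$ (i, a) * (ws ! n) $ a * cnj (K $$ (j, b) * (ws ! n) $ b)) =
          (K *\<^sub>v (ws ! n)) $ i * cnj ((K *\<^sub>v (ws ! n)) $ j)"
        using K' ij w by (simp add: scalar_prod_def sum_product lessThan_atLeast0)
    qed
    finally show ?thesis by (simp add: sum_list_nth)
  qed
  have "kraus_apply d' Ks \<rho> $$ (i, j) =
      (\<Sum>w\<leftarrow>[K *\<^sub>v w. K \<leftarrow> Ks, w \<leftarrow> ws]. w $ i * cnj (w $ j))" if "i < d'" "j < d'" for i j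
  proof -
    have "kraus_apply d' Ks \<rho> $$ (i, j) = (\<Sum>K\<leftarrow>Ks. (K * \<rho> * mat_adjoint K) $$ (i, j))"
      unfolding kraus_apply_def using car that by (subst mats_sum_index) (auto simp: o_def)
    also have "\<dots> = (\<Sum>K\<leftarrow>Ks. \<Sum>w\<leftarrow>ws. (K *\<^sub>v w) $ i * cnj ((K *\<^sub>v w) $ j))"
      using that by (intro arg_cong[where f = sum_list] map_cong refl entry)
    also have "\<dots> = (\<Sum>w\<leftarrow>[K *\<^sub>v w. K \<leftarrow> Ks, w \<leftarrow> ws]. w $ i * cnj (w $ j))"
      by (induction Ks) (simp_all add: o_def)
    finally show ?thesis .
  qed
  moreover have "kraus_apply d' Ks \<rho> \<in> carrier_mat d' d'"
    unfolding kraus_apply_def using car by (intro mats_sum_index) auto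
  moreover have "set [K *\<^sub>v w. K \<leftarrow> Ks, w \<leftarrow> ws] \<subseteq> carrier_vec d'"
    using K ws by (fastforce intro: mult_mat_vec_carrier)
  ultimately show ?thesis by (simp add: ensemble_def)
qed

section \<open>Ensembles whose reduced state is the EPR pair\<close>

lemma sum_sum_list_norm_zero:
  assumes "finite S" and "(\<Sum>k\<in>S. \<Sum>w\<leftarrow>ws. (cmod (h w k))\<^sup>2) = 0" and "w \<in> set ws" and "k \<in> S"
  shows "h w k = 0"
proof -
  have "\<forall>k\<in>S. (\<Sum>w\<leftarrow>ws. (cmod (h w k))\<^sup>2) = 0"
    using assms(1,2) by (subst (asm) sum_nonneg_eq_0_iff) (auto intro!: sum_list_nonneg)
  then show ?thesis
    using assms(3,4) by (subst (asm) sum_list_nonneg_eq_0_iff) auto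
qed

lemma epr_simps: "dim_vec epr = 4" "epr $ 0 = 1 / of_real (sqrt 2)" "epr $ 1 = 0"
    "epr $ Suc 0 = 0" "epr $ 2 = 0" "epr $ 3 = 1 / of_real (sqrt 2)"
  by (simp_all add: epr_def vec_of_list_index numeral_2_eq_2 numeral_3_eq_3)

text \<open>A pure state is extremal: the reduced state has expectation 0 at |01>, |10> and |00> -
  |11>, all orthogonal to \<open>epr\<close>. These expectations are sums of squares over w and the
  traced-out index k, so each single term vanishes.\<close>

lemma epr_components:
  assumes "finite S"
    and eq: "\<And>i j. i < 4 \<Longrightarrow> j < 4 \<Longrightarrow>
      (\<Sum>k\<in>S. \<Sum>w\<leftarrow>ws. g w i k * cnj (g w j k)) = pure_density epr $$ (i, j)"
    and w: "w \<in> set ws" and k: "k \<in> S"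
  shows "g w 1 k = 0 \<and> g w 2 k = 0 \<and> g w 0 k = g w 3 k"
proof -
  have cm: "complex_of_real (\<Sum>k\<in>S. \<Sum>w\<leftarrow>ws. (cmod (h w k))\<^sup>2) = (\<Sum>k\<in>S. \<Sum>w\<leftarrow>ws. h w k * cnj (h w k))"
    for h unfolding mult_cnj_self sum_list_nth by simp
  have "g w i k = 0" if "i = 1 \<or> i = 2" for i
  proof -
    have "complex_of_real (\<Sum>k\<in>S. \<Sum>w\<leftarrow>ws. (cmod (g w i k))\<^sup>2) = 0"
      unfolding cm using that eq[of i i] by (auto simp: pure_density_def epr_simps)
    then show ?thesis
      using sum_sum_list_norm_zero[OF assms(1) _ w k, of "\<lambda>w k. g w i k"] by (simp only: of_real_eq_0_iff)
  qed
  moreover have "g w 0 k - g w 3 k = 0"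
  proof -
    have "(\<Sum>k\<in>S. \<Sum>w\<leftarrow>ws. (g w 0 k - g w 3 k) * cnj (g w 0 k - g w 3 k)) =
      (\<Sum>k\<in>S. \<Sum>w\<leftarrow>ws. g w 0 k * cnj (g w 0 k)) - (\<Sum>k\<in>S. \<Sum>w\<leftarrow>ws. g w 0 k * cnj (g w 3 k))
      - ((\<Sum>k\<in>S. \<Sum>w\<leftarrow>ws. g w 3 k * cnj (g w 0 k)) - (\<Sum>k\<in>S. \<Sum>w\<leftarrow>ws. g w 3 k * cnj (g w 3 k)))"
      unfolding sum_list_nth by (simp add: algebra_simps sum.distrib sum_subtractf)
    also have "\<dots> = 0" by (simp add: eq pure_density_def epr_simps)
    finally have "complex_of_real (\<Sum>k\<in>S. \<Sum>w\<leftarrow>ws. (cmod (g w 0 k - g w 3 k))\<^sup>2) = 0"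
      unfolding cm .
    then show ?thesis
      using sum_sum_list_norm_zero[OF assms(1) _ w k, of "\<lambda>w k. g w 0 k - g w 3 k"] by (simp only: of_real_eq_0_iff)
  qed
  ultimately show ?thesis by simp
qed

section \<open>Index arithmetic for local operations on tensor products\<close>

lemma one_kron_carrier:
  "M \<in> carrier_mat a a' \<Longrightarrow> N \<in> carrier_mat b b' \<Longrightarrow>
    1\<^sub>m 2 \<otimes>\<^sub>m M \<otimes>\<^sub>m N \<in> carrier_mat (2 * (a * b)) (2 * (a' * b'))"
  by (auto simp: kron_mat_def)

lemma mult_add_less: "i < a \<Longrightarrow> j < b \<Longrightarrow> i * b + j < a * (b::nat)"
  using mult_le_mono1[of "Suc i" a b] by simp

lemma kron_mat_index:
  assumes "M \<in> carrier_mat a a'" "N \<in> carrier_mat b b'" "i < a" "j < b" "i' < a'" "j' < b'"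
  shows "(M \<otimes>\<^sub>m N) $$ (i * b + j, i' * b' + j') = M $$ (i, i') * N $$ (j, j')"
  using assms by (auto simp: kron_mat_def mult_add_less)

lemma one_kron_mult_vec_index:
  assumes M: "M \<in> carrier_mat a a'" and N: "N \<in> carrier_mat b b'" and u: "u \<in> carrier_vec (2 * (a' * b'))"
    and "r < 2" "i < a" "j < b"
  shows "((1\<^sub>m 2 \<otimes>\<^sub>m M \<otimes>\<^sub>m N) *\<^sub>v u) $ (r * (a * b) + (i * b + j)) =
    (\<Sum>i'<a'. \<Sum>j'<b'. M $$ (i, i') * N $$ (j, j') * u $ (r * (a' * b') + (i' * b' + j')))"
proof -
  have MN: "M \<otimes>\<^sub>m N \<in> carrier_mat (a * b) (a' * b')" using M N by (auto simp: kron_mat_def)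
  have ij: "i * b + j < a * b" using assms by (intro mult_add_less)
  have idx: "r * (a * b) + (i * b + j) < 2 * (a * b)" using \<open>r < 2\<close> ij by (rule mult_add_less)
  have "((1\<^sub>m 2 \<otimes>\<^sub>m M \<otimes>\<^sub>m N) *\<^sub>v u) $ (r * (a * b) + (i * b + j)) =
      (\<Sum>l<2 * (a' * b'). (1\<^sub>m 2 \<otimes>\<^sub>m M \<otimes>\<^sub>m N) $$ (r * (a * b) + (i * b + j), l) * u $ l)"
    using one_kron_carrier[OF M N] u idx by (auto simp: scalar_prod_def lessThan_atLeast0)
  also have "\<dots> = (\<Sum>r'<2. \<Sum>l<a' * b'.
      (if r = r' then (M \<otimes>\<^sub>m N) $$ (i * b + j, l) else 0) * u $ (r' * (a' * b') + l))"
    unfolding sum_lessThan_mult using \<open>r < 2\<close> ij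
    by (intro sum.cong refl arg_cong2[where f = "(*)"], subst kron_mat_index[OF one_carrier_mat MN])
      (auto intro: mult_add_less)
  also have "\<dots> = (\<Sum>l<a' * b'. (M \<otimes>\<^sub>m N) $$ (i * b + j, l) * u $ (r * (a' * b') + l))"
    using \<open>r < 2\<close> by (auto simp: sum_less_two less_2_cases_iff)
  also have "\<dots> = (\<Sum>i'<a'. \<Sum>j'<b'. M $$ (i, i') * N $$ (j, j') * u $ (r * (a' * b') + (i' * b' + j')))"
    unfolding sum_lessThan_mult using assms
    by (intro sum.cong refl arg_cong2[where f = "(*)"] kron_mat_index) auto
  finally show ?thesis .
qed

lemma set_local_ops:
  assumes "set Ks \<subseteq> carrier_mat a a'" and "set Ls \<subseteq> carrier_mat b b'"
  shows "set (local_ops Ks Ls) \<subseteq> carrier_mat (2 * (a * b)) (2 * (a' * b'))"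
proof
  fix M assume "M \<in> set (local_ops Ks Ls)"
  then obtain K L where "K \<in> set Ks" "L \<in> set Ls" "M = 1\<^sub>m 2 \<otimes>\<^sub>m K \<otimes>\<^sub>m L"
    by (auto simp: local_ops_def)
  then show "M \<in> carrier_mat (2 * (a * b)) (2 * (a' * b'))"
    using assms one_kron_carrier by blast
qed

section \<open>Amplitudes of an attack\<close>

text \<open>With \<open>\<phi>\<close> the image of \<open>\<psi>\<close> under Bob's Kraus operator, \<open>amp dA K \<phi> r i j\<close> is \<open>\<surd>2\<close> times the
  amplitude of \<open>|r\<rangle>|i\<rangle>|j\<rangle>\<close> after Alice applied K to \<open>epr \<otimes> \<psi>\<close>: the EPR pair makes column block r
  of K act when the reference qubit is in state r.\<close>

definition amp :: "nat \<Rightarrow> complex mat \<Rightarrow> (nat \<Rightarrow> nat \<Rightarrow> complex) \<Rightarrow> nat \<Rightarrow> nat \<Rightarrow> nat \<Rightarrow> complex" where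
  "amp dA K \<phi> r i j = (\<Sum>\<alpha><dA. K $$ (i, r * dA + \<alpha>) * \<phi> \<alpha> j)"

definition bob_image :: "nat \<Rightarrow> complex vec \<Rightarrow> (nat \<Rightarrow> nat \<Rightarrow> complex) \<Rightarrow> nat \<Rightarrow> nat \<Rightarrow> complex" where
  "bob_image dB \<psi> L \<alpha> j = (\<Sum>\<beta><dB. L j \<beta> * \<psi> $ (\<alpha> * dB + \<beta>))"

lemma initial_vec_carrier:
  "\<psi> \<in> carrier_vec (dA * dB) \<Longrightarrow> epr \<otimes>\<^sub>v \<psi> \<in> carrier_vec (2 * ((2 * dA) * dB))"
  by (rule carrier_vecI) (simp add: kron_vec_def carrier_vecD epr_simps)

lemma initial_vec_index:
  assumes "\<psi> \<in> carrier_vec (dA * dB)" "r < 2" "q < 2" "\<alpha> < dA" "\<beta> < dB"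
  shows "(epr \<otimes>\<^sub>v \<psi>) $ (r * ((2 * dA) * dB) + ((q * dA + \<alpha>) * dB + \<beta>)) =
    (if q = r then \<psi> $ (\<alpha> * dB + \<beta>) / of_real (sqrt 2) else 0)"
proof -
  \<comment> \<open>Regroups the registers from R, (Q, A), B to (R, Q), (A, B), where
    \<open>epr\<close> and \<psi> factor; \<open>2 * r + q\<close> is the index into
    \<open>epr\<close>.\<close>
  have idx: "r * ((2 * dA) * dB) + ((q * dA + \<alpha>) * dB + \<beta>) = (2 * r + q) * (dA * dB) + (\<alpha> * dB + \<beta>)"
    by (simp add: algebra_simps)
  have ab: "\<alpha> * dB + \<beta> < dA * dB" using assms by (intro mult_add_less)
  have "(2 * r + q) * (dA * dB) + (\<alpha> * dB + \<beta>) < 4 * (dA * dB)"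
    by (rule mult_add_less[OF _ ab]) (use assms(2,3) in auto)
  moreover have dm: "(m * k + l) div k = m" "(m * k + l) mod k = l" if "l < k" for m k l :: nat
    using that by auto
  ultimately have "(epr \<otimes>\<^sub>v \<psi>) $ (r * ((2 * dA) * dB) + ((q * dA + \<alpha>) * dB + \<beta>)) =
      epr $ (2 * r + q) * \<psi> $ (\<alpha> * dB + \<beta>)"
    unfolding idx using carrier_vecD[OF assms(1)] by (simp add: kron_vec_def epr_simps dm[OF ab] mod_less[OF ab])
  moreover have "epr $ (2 * r + q) = (if q = r then 1 / of_real (sqrt 2) else 0)"
    using assms(2,3) by (auto simp: less_2_cases_iff epr_simps)
  ultimately show ?thesis by simp
qed

lemma measured_vec_index:
  assumes \<psi>: "\<psi> \<in> carrier_vec (dA * dB)" and K: "K \<in> carrier_mat a (2 * dA)" and L: "L \<in> carrier_mat b dB"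
    and "r < 2" "i < a" "j < b"
  shows "((1\<^sub>m 2 \<otimes>\<^sub>m K \<otimes>\<^sub>m L) *\<^sub>v (epr \<otimes>\<^sub>v \<psi>)) $ (r * (a * b) + (i * b + j)) =
    amp dA K (bob_image dB \<psi> (\<lambda>j \<beta>. L $$ (j, \<beta>))) r i j / of_real (sqrt 2)"
proof -
  have "((1\<^sub>m 2 \<otimes>\<^sub>m K \<otimes>\<^sub>m L) *\<^sub>v (epr \<otimes>\<^sub>v \<psi>)) $ (r * (a * b) + (i * b + j)) =
      (\<Sum>q<2. \<Sum>\<alpha><dA. \<Sum>\<beta><dB. K $$ (i, q * dA + \<alpha>) * L $$ (j, \<beta>) *
        (if q = r then \<psi> $ (\<alpha> * dB + \<beta>) / of_real (sqrt 2) else 0))"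
    unfolding one_kron_mult_vec_index[OF K L initial_vec_carrier[OF \<psi>] assms(4-6)] sum_lessThan_mult
    using assms(4) by (intro sum.cong refl arg_cong2[where f = "(*)"] initial_vec_index[OF \<psi>]) auto
  also have "\<dots> = (\<Sum>q<2. if q = r then \<Sum>\<alpha><dA. \<Sum>\<beta><dB. K $$ (i, q * dA + \<alpha>) * L $$ (j, \<beta>) *
        (\<psi> $ (\<alpha> * dB + \<beta>) / of_real (sqrt 2)) else 0)"
    by (intro sum.cong refl) auto
  also have "\<dots> = (\<Sum>\<alpha><dA. \<Sum>\<beta><dB. K $$ (i, r * dA + \<alpha>) * L $$ (j, \<beta>) *
        (\<psi> $ (\<alpha> * dB + \<beta>) / of_real (sqrt 2)))"
    using assms(4) by simp
  also have "\<dots> = amp dA K (bob_image dB \<psi> (\<lambda>j \<beta>. L $$ (j, \<beta>))) r i j / of_real (sqrt 2)"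
    by (simp add: amp_def bob_image_def sum_distrib_left sum_divide_distrib mult.assoc)
  finally show ?thesis .
qed

lemma ensemble_trace:
  assumes "ensemble d \<rho> ws"
  shows "mat_trace \<rho> = of_real (\<Sum>i<d. \<Sum>w\<leftarrow>ws. (cmod (w $ i))\<^sup>2)"
proof -
  have "mat_trace \<rho> = (\<Sum>i<d. \<Sum>w\<leftarrow>ws. w $ i * cnj (w $ i))"
    using assms by (auto simp: ensemble_def mat_trace_def)
  then show ?thesis by (simp add: sum_list_nth mult_cnj_self)
qed

lemma reduced_Alice_index:
  assumes "ensemble (2 * ((2 * restA P) * (2 * restB P))) \<rho> ws" and ij: "i < 4" "j < 4"
  shows "reduced_Alice P \<rho> $$ (i, j) = (\<Sum>k<restA P * (2 * restB P). \<Sum>w\<leftarrow>ws.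
    w $ (i * (restA P * (2 * restB P)) + k) * cnj (w $ (j * (restA P * (2 * restB P)) + k)))"
proof -
  define b where "b = restA P * (2 * restB P)"
  have "reduced_Alice P \<rho> $$ (i, j) = (\<Sum>k<b. \<rho> $$ (i * b + k, j * b + k))"
    using ij by (simp add: reduced_Alice_def partial_trace_def b_def)
  also have "\<dots> = (\<Sum>k<b. \<Sum>w\<leftarrow>ws. w $ (i * b + k) * cnj (w $ (j * b + k)))"
  proof (intro sum.cong refl)
    fix k assume "k \<in> {..<b}"
    then have "i * b + k < 4 * b" "j * b + k < 4 * b" using ij by (auto intro!: mult_add_less)
    then show "\<rho> $$ (i * b + k, j * b + k) = (\<Sum>w\<leftarrow>ws. w $ (i * b + k) * cnj (w $ (j * b + k)))"
      using assms(1) by (auto simp: ensemble_def b_def)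
  qed
  finally show ?thesis by (simp only: b_def)
qed

text \<open>Here \<open>i div 2\<close> is the reference qubit and \<open>i mod 2\<close> Bob's
  output qubit. Traced out are k, Alice's whole output system, and l, Bob's remaining system; both
  are merged into a single index for use with \<open>epr_components\<close>.\<close>

lemma reduced_Bob_index:
  assumes "ensemble (2 * ((2 * restA P) * (2 * restB P))) \<rho> ws" and ij: "i < 4" "j < 4"
  defines "g \<equiv> \<lambda>w i (l, k). w $ ((i div 2) * ((2 * restA P) * (2 * restB P)) +
    (k * (2 * restB P) + ((i mod 2) * restB P + l)))"
  shows "reduced_Bob P \<rho> $$ (i, j) =
    (\<Sum>p\<in>{..<restB P} \<times> {..<2 * restA P}. \<Sum>w\<leftarrow>ws. g w i p * cnj (g w j p))"
proof -
  define a where "a = 2 * restA P"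
  define c where "c = 2 * restB P"
  have dm: "(i * restB P + l) div c = i div 2" "(i * restB P + l) mod c = (i mod 2) * restB P + l"
    "i * restB P + l < 2 * c" "(i mod 2) * restB P + l < c"
    if "i < 4" "l < restB P" for i l
  proof -
    have eq: "i * restB P + l = (i div 2) * c + ((i mod 2) * restB P + l)"
    proof -
      have "(i div 2) * c + (i mod 2) * restB P = (i div 2 * 2 + i mod 2) * restB P"
        by (simp only: c_def add_mult_distrib mult.assoc)
      then show ?thesis by simp
    qed
    show less: "(i mod 2) * restB P + l < c"
      unfolding c_def using that by (intro mult_add_less) auto
    show "(i * restB P + l) div c = i div 2" "(i * restB P + l) mod c = (i mod 2) * restB P + l"
      unfolding eq using less by auto
    show "i * restB P + l < 2 * c"
      unfolding eq using less that by (intro mult_add_less) auto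
  qed
  have "reduced_Bob P \<rho> $$ (i, j) = (\<Sum>l<restB P.
      partial_trace 2 a c \<rho> $$ (i * restB P + l, j * restB P + l))"
    using ij by (simp add: reduced_Bob_def partial_trace_def[of 4] a_def c_def)
  also have "\<dots> = (\<Sum>l<restB P. \<Sum>k<a. \<rho> $$ (((i div 2) * a + k) * c + ((i mod 2) * restB P + l),
      ((j div 2) * a + k) * c + ((j mod 2) * restB P + l)))"
    using ij by (intro sum.cong refl) (simp add: partial_trace_def dm)
  also have "\<dots> = (\<Sum>l<restB P. \<Sum>k<a. \<Sum>w\<leftarrow>ws. g w i (l, k) * cnj (g w j (l, k)))"
  proof (intro sum.cong refl)
    fix l k assume lk: "l \<in> {..<restB P}" "k \<in> {..<a}"
    have idx: "((i div 2) * a + k) * c + ((i mod 2) * restB P + l) =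
        (i div 2) * (a * c) + (k * c + ((i mod 2) * restB P + l))" for i
      by (simp add: algebra_simps)
    have "(i div 2) * (a * c) + (k * c + ((i mod 2) * restB P + l)) < 2 * (a * c)" if "i < 4" for i
      using that lk dm(4)[OF that] by (intro mult_add_less) auto
    then show "\<rho> $$ (((i div 2) * a + k) * c + ((i mod 2) * restB P + l),
        ((j div 2) * a + k) * c + ((j mod 2) * restB P + l)) =
        (\<Sum>w\<leftarrow>ws. g w i (l, k) * cnj (g w j (l, k)))"
      unfolding idx using assms(1) ij by (auto simp: ensemble_def a_def c_def g_def)
  qed
  finally show ?thesis by (simp add: sum.cartesian_product a_def)
qed

text \<open>Up to a scalar, \<open>W r i j\<close> is the amplitude of |r>|i>|j> in the branch given
  by K, L, D, E. This branch is one vector of the final ensemble, so \<open>epr_components\<close>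
  applies to it. Row \<open>q * restA P + l\<close> of D (with \<open>restB P\<close>, of E) carries
  output qubit q: amplitudes with q different from r vanish, and those for q = r = 0 and q = r = 1
  agree.\<close>

lemma final_amplitudes:
  fixes P :: attack and x y s t
  assumes valid: "valid_attack n P" and perfect: "perfect_attack n f P"
    and x: "x \<in> bitstrings n" and y: "y \<in> bitstrings n" and st: "(s, t) \<in> outcomes P x y"
    and K: "K \<in> set (measA P x ! s)" and L: "L \<in> set (measB P y ! t)"
    and D: "D \<in> set (finalA P x s (msgB P y t))" and E: "E \<in> set (finalB P y t (msgA P x s))"
  defines "a \<equiv> amp (2 ^ qA P) K (bob_image (2 ^ qB P) (shared P) (\<lambda>j \<beta>. L $$ (j, \<beta>)))"
  defines "W \<equiv> \<lambda>r i j. \<Sum>i'<dimA P. \<Sum>j'<dimB P. D $$ (i, i') * E $$ (j, j') * a r i' j'"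
  shows "\<not> f x y \<Longrightarrow> l < restA P \<Longrightarrow> j < 2 * restB P \<Longrightarrow>
      W 0 (restA P + l) j = 0 \<and> W 1 l j = 0 \<and> W 0 l j = W 1 (restA P + l) j"
    and "f x y \<Longrightarrow> i < 2 * restA P \<Longrightarrow> l < restB P \<Longrightarrow>
      W 0 i (restB P + l) = 0 \<and> W 1 i l = 0 \<and> W 0 i l = W 1 i (restB P + l)"
proof -
  define dA dB where "dA = (2::nat) ^ qA P" and "dB = (2::nat) ^ qB P"
  define u where "u = epr \<otimes>\<^sub>v shared P"
  define v where "v = (1\<^sub>m 2 \<otimes>\<^sub>m K \<otimes>\<^sub>m L) *\<^sub>v u"
  let ?d1 = "2 * (dimA P * dimB P)"
  let ?d2 = "2 * ((2 * restA P) * (2 * restB P))"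
  have \<psi>: "shared P \<in> carrier_vec (dA * dB)"
    using valid by (simp add: valid_attack_def unit_vector_def dA_def dB_def)
  have s: "s < length (measA P x)" and t: "t < length (measB P y)"
    using st by (auto simp: outcomes_def)
  have "instrument (2 * dA) (dimA P) (measA P x)" "instrument dB (dimB P) (measB P y)"
    using valid x y by (auto simp: valid_attack_def dA_def dB_def)
  then have "set (concat (measA P x)) \<subseteq> carrier_mat (dimA P) (2 * dA)"
    "set (concat (measB P y)) \<subseteq> carrier_mat (dimB P) dB"
    by (auto simp: instrument_def kraus_complete_def)
  then have Ks: "set (measA P x ! s) \<subseteq> carrier_mat (dimA P) (2 * dA)"
    and Ls: "set (measB P y ! t) \<subseteq> carrier_mat (dimB P) dB"
    using nth_mem[OF s] nth_mem[OF t] by auto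
  have "kraus_complete (dimA P) (2 * restA P) (finalA P x s (msgB P y t)) \<and>
        kraus_complete (dimB P) (2 * restB P) (finalB P y t (msgA P x s))"
    using valid[unfolded valid_attack_def, THEN conjunct2, THEN conjunct2, THEN conjunct2,
      rule_format, OF x y st] by simp
  then have Ds: "set (finalA P x s (msgB P y t)) \<subseteq> carrier_mat (2 * restA P) (dimA P)"
    and Es: "set (finalB P y t (msgA P x s)) \<subseteq> carrier_mat (2 * restB P) (dimB P)"
    by (auto simp: kraus_complete_def)
  define ws1 where "ws1 = [M *\<^sub>v w. M \<leftarrow> local_ops (measA P x ! s) (measB P y ! t), w \<leftarrow> [u]]"
  have e1: "ensemble ?d1 (measured_state P x y s t) ws1"
    unfolding ws1_def measured_state_def initial_state_def u_def
    by (rule ensemble_kraus_apply[OF ensemble_pure_density[OF initial_vec_carrier[OF \<psi>]] set_local_ops[OF Ks Ls]])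
  have v1: "v \<in> set ws1" using K L by (auto simp: ws1_def v_def local_ops_def)
  have v_carrier: "v \<in> carrier_vec ?d1" using e1 v1 by (auto simp: ensemble_def)
  have v_index: "v $ (r * (dimA P * dimB P) + (i * dimB P + j)) = a r i j / of_real (sqrt 2)"
    if "r < 2" "i < dimA P" "j < dimB P" for r i j
    unfolding v_def u_def a_def using measured_vec_index[OF \<psi> _ _ that] Ks Ls K L
    by (auto simp: dA_def dB_def)
  define p where "p = outcome_prob P x y s t"
  have p: "p = (\<Sum>i<?d1. \<Sum>w\<leftarrow>ws1. (cmod (w $ i))\<^sup>2)"
    unfolding p_def outcome_prob_def ensemble_trace[OF e1] by simp
  have p_nonneg: "p \<ge> 0" unfolding p by (intro sum_nonneg sum_list_nonneg) auto
  \<comment> \<open>A perfect attack promises nothing for outcomes of probability 0, but there all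
    amplitudes are 0 and the equations hold trivially.\<close>
  consider "p = 0" | "p > 0" using p_nonneg by linarith
  then have "(\<not> f x y \<longrightarrow> (\<forall>l<restA P. \<forall>j<2 * restB P.
      W 0 (restA P + l) j = 0 \<and> W 1 l j = 0 \<and> W 0 l j = W 1 (restA P + l) j)) \<and>
    (f x y \<longrightarrow> (\<forall>i<2 * restA P. \<forall>l<restB P.
      W 0 i (restB P + l) = 0 \<and> W 1 i l = 0 \<and> W 0 i l = W 1 i (restB P + l)))"
  proof cases
    case 1
    have "v $ i = 0" if "i < ?d1" for i
      using sum_sum_list_norm_zero[where h = "\<lambda>w i. w $ i" and S = "{..<?d1}", OF _ _ v1] 1 that
      by (simp add: p)
    moreover have "r * (dimA P * dimB P) + (i * dimB P + j) < ?d1"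
      if "r < 2" "i < dimA P" "j < dimB P" for r i j
      using that by (intro mult_add_less)
    ultimately have a0: "a r i j = 0" if "r < 2" "i < dimA P" "j < dimB P" for r i j
      using v_index[OF that] that by simp
    have "W r i j = 0" if "r < 2" for r i j
      unfolding W_def using that a0 by (intro sum.neutral) auto
    then show ?thesis by simp
  next
    case 2
    \<comment> \<open>Collects the normalisation of the post-measurement state and the factor 1/sqrt
      2 of the EPR pair; only \<open>c \<noteq> 0\<close> matters.\<close>
    define c where "c = sqrt (1 / p) / sqrt 2"
    have c: "c \<noteq> 0" using 2 by (simp add: c_def)
    define v' where "v' = complex_of_real (sqrt (1 / p)) \<cdot>\<^sub>v v"
    define w where "w = (1\<^sub>m 2 \<otimes>\<^sub>m D \<otimes>\<^sub>m E) *\<^sub>v v'"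
    define ws2 where "ws2 = [M *\<^sub>v w. M \<leftarrow> local_ops (finalA P x s (msgB P y t)) (finalB P y t (msgA P x s)),
      w \<leftarrow> map ((\<cdot>\<^sub>v) (complex_of_real (sqrt (1 / p)))) ws1]"
    have e2: "ensemble ?d2 (final_state P x y s t) ws2"
      unfolding ws2_def final_state_def post_measurement_state_def p_def[symmetric]
      using 2 by (intro ensemble_kraus_apply[OF ensemble_smult[OF e1] set_local_ops[OF Ds Es]]) simp
    have w2: "w \<in> set ws2"
      unfolding ws2_def w_def v'_def local_ops_def using D E v1 by auto
    have v'_carrier: "v' \<in> carrier_vec ?d1" using v_carrier by (simp add: v'_def)
    have w_index: "w $ (r * ((2 * restA P) * (2 * restB P)) + (i * (2 * restB P) + j)) = of_real c * W r i j"
      if "r < 2" "i < 2 * restA P" "j < 2 * restB P" for r i j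
    proof -
      have D': "D \<in> carrier_mat (2 * restA P) (dimA P)" and E': "E \<in> carrier_mat (2 * restB P) (dimB P)"
        using D E Ds Es by auto
      have "w $ (r * ((2 * restA P) * (2 * restB P)) + (i * (2 * restB P) + j)) =
        (\<Sum>i'<dimA P. \<Sum>j'<dimB P. D $$ (i, i') * E $$ (j, j') * (of_real c * a r i' j'))"
        unfolding w_def one_kron_mult_vec_index[OF D' E' v'_carrier that]
      proof (intro sum.cong refl arg_cong2[where f = "(*)"])
        fix i' j' assume ij: "i' \<in> {..<dimA P}" "j' \<in> {..<dimB P}"
        have "r * (dimA P * dimB P) + (i' * dimB P + j') < ?d1"
          using ij \<open>r < 2\<close> by (intro mult_add_less) auto
        then show "v' $ (r * (dimA P * dimB P) + (i' * dimB P + j')) = of_real c * a r i' j'"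
          using v_carrier ij \<open>r < 2\<close> by (simp add: v'_def v_index c_def)
      qed
      then show ?thesis by (simp add: W_def sum_distrib_left mult_ac)
    qed
    have final: "(if f x y then reduced_Bob P (final_state P x y s t)
         else reduced_Alice P (final_state P x y s t)) = pure_density epr"
      using perfect[unfolded perfect_attack_def, rule_format, OF x y st] 2 by (simp add: p_def)
    show ?thesis
    proof (intro conjI impI allI)
      fix l j assume "\<not> f x y" and lj: "l < restA P" "j < 2 * restB P"
      let ?b = "restA P * (2 * restB P)" and ?k = "l * (2 * restB P) + j"
      have k: "?k < ?b" using lj by (intro mult_add_less)
      have *: "w $ (1 * ?b + ?k) = 0 \<and> w $ (2 * ?b + ?k) = 0 \<and> w $ (0 * ?b + ?k) = w $ (3 * ?b + ?k)"
      proof (rule epr_components[where S = "{..<?b}" and g = "\<lambda>w i k. w $ (i * ?b + k)", OF _ _ w2])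
        fix i j :: nat assume "i < 4" "j < 4"
        then show "(\<Sum>k<?b. \<Sum>w\<leftarrow>ws2. w $ (i * ?b + k) * cnj (w $ (j * ?b + k))) = pure_density epr $$ (i, j)"
          using final \<open>\<not> f x y\<close> reduced_Alice_index[OF e2] by simp
      qed (use k in auto)
      \<comment> \<open>\<open>2 * r + q\<close> codes reference qubit r and Alice's output qubit q;
        the right-hand side regroups q with l into a row of D.\<close>
      have idx: "(2 * r + q) * ?b + ?k = r * ((2 * restA P) * (2 * restB P)) + ((q * restA P + l) * (2 * restB P) + j)"
        for r q by (simp add: algebra_simps)
      have "w $ ((2 * r + q) * ?b + ?k) = of_real c * W r (q * restA P + l) j" if "r < 2" "q < 2" for r q
        unfolding idx by (intro w_index that lj mult_add_less)
      from this[of 0 0] this[of 0 1] this[of 1 0] this[of 1 1] *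
      show "W 0 (restA P + l) j = 0" "W 1 l j = 0" "W 0 l j = W 1 (restA P + l) j"
        using c by auto
    next
      fix i l assume "f x y" and il: "i < 2 * restA P" "l < restB P"
      let ?g = "\<lambda>w i (l, k). w $ ((i div 2) * ((2 * restA P) * (2 * restB P)) +
        (k * (2 * restB P) + ((i mod 2) * restB P + l)))"
      have *: "?g w 1 (l, i) = 0 \<and> ?g w 2 (l, i) = 0 \<and> ?g w 0 (l, i) = ?g w 3 (l, i)"
      proof (rule epr_components[where S = "{..<restB P} \<times> {..<2 * restA P}" and g = ?g, OF _ _ w2])
        fix i j :: nat assume "i < 4" "j < 4"
        from reduced_Bob_index[OF e2 this]
        show "(\<Sum>p\<in>{..<restB P} \<times> {..<2 * restA P}. \<Sum>w\<leftarrow>ws2. ?g w i p * cnj (?g w j p)) = pure_density epr $$ (i, j)"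
          using final \<open>f x y\<close> by simp
      qed (use il in auto)
      have "?g w (2 * r + q) (l, i) = of_real c * W r i (q * restB P + l)" if "r < 2" "q < 2" for r q
        using w_index[of r i "q * restB P + l"] that il mult_add_less[of q 2 l "restB P"] by simp
      from this[of 0 0] this[of 0 1] this[of 1 0] this[of 1 1] *
      show "W 0 i (restB P + l) = 0" "W 1 i l = 0" "W 0 i l = W 1 i (restB P + l)"
        using c by auto
    qed
  qed
  then show "\<not> f x y \<Longrightarrow> l < restA P \<Longrightarrow> j < 2 * restB P \<Longrightarrow>
      W 0 (restA P + l) j = 0 \<and> W 1 l j = 0 \<and> W 0 l j = W 1 (restA P + l) j"
    and "f x y \<Longrightarrow> i < 2 * restA P \<Longrightarrow> l < restB P \<Longrightarrow>
      W 0 i (restB P + l) = 0 \<and> W 1 i l = 0 \<and> W 0 i l = W 1 i (restB P + l)"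
    by blast+
qed

section \<open>Separation\<close>

text \<open>The value at c of the Hermitian form given by the reduced state, on Alice's side, of the vector
  with amplitudes \<open>b i k\<close>.\<close>

definition form_sq :: "nat \<Rightarrow> nat \<Rightarrow> (nat \<Rightarrow> nat \<Rightarrow> complex) \<Rightarrow> (nat \<Rightarrow> complex) \<Rightarrow> real" where
  "form_sq B m b c = (\<Sum>k<B. (cmod (\<Sum>i<m. c i * b i k))\<^sup>2)"

text \<open>The rows below h and from h on of a Kraus operator D of Alice's decoder belong to output qubit
  0 and 1, respectively.  The conditions only involve Alice's reduced state, hence survive
  the compression of Bob's system.  \<open>bob_good\<close> says that Alice's reduced state does not
  depend on the reference qubit.\<close>

definition alice_good :: "nat \<Rightarrow> nat \<Rightarrow> nat \<Rightarrow> complex mat list \<Rightarrow> (nat \<Rightarrow> nat \<Rightarrow> nat \<Rightarrow> complex) \<Rightarrow> bool" where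
  "alice_good B m h Ds b \<longleftrightarrow> (\<forall>D\<in>set Ds. \<forall>l<h.
     form_sq B m (b 0) (\<lambda>i. D $$ (h + l, i)) = 0 \<and> form_sq B m (b 1) (\<lambda>i. D $$ (l, i)) = 0 \<and>
     form_sq B m (b 0) (\<lambda>i. D $$ (l, i)) = form_sq B m (b 1) (\<lambda>i. D $$ (h + l, i)))"

definition bob_good :: "nat \<Rightarrow> nat \<Rightarrow> (nat \<Rightarrow> nat \<Rightarrow> nat \<Rightarrow> complex) \<Rightarrow> bool" where
  "bob_good B m b \<longleftrightarrow> (\<forall>c. form_sq B m (b 0) c = form_sq B m (b 1) c)"

lemma form_sq_nonneg: "form_sq B m b c \<ge> 0"
  by (simp add: form_sq_def sum_nonneg)

lemma form_sq_add_le: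
  assumes "\<And>i k. i < m \<Longrightarrow> k < B \<Longrightarrow> b i k = b' i k + d i k"
  shows "form_sq B m b c \<le> 2 * form_sq B m b' c + 2 * form_sq B m d c"
proof -
  have "form_sq B m b c = (\<Sum>k<B. (cmod ((\<Sum>i<m. c i * b' i k) + (\<Sum>i<m. c i * d i k)))\<^sup>2)"
    by (simp add: form_sq_def assms distrib_left sum.distrib)
  also have "\<dots> \<le> (\<Sum>k<B. 2 * (cmod (\<Sum>i<m. c i * b' i k))\<^sup>2 + 2 * (cmod (\<Sum>i<m. c i * d i k))\<^sup>2)"
    by (intro sum_mono cmod_add_sq_le)
  finally show ?thesis by (simp add: form_sq_def sum.distrib sum_distrib_left)
qed

lemma sum_less_double: "(\<Sum>i<2 * h. f i) = (\<Sum>l<h. f l) + (\<Sum>l<h::nat. f (h + l))"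
  unfolding sum_lessThan_mult by (simp add: sum_less_two)

text \<open>Completeness of the decoder splits the total mass into the masses decoded to qubit value
  0 and to qubit value 1.\<close>

lemma kraus_complete_blocks:
  assumes "kraus_complete m (2 * h) Ds"
  shows "(\<Sum>D\<leftarrow>Ds. \<Sum>l<h. form_sq B m b (\<lambda>i. D $$ (l, i))) +
      (\<Sum>D\<leftarrow>Ds. \<Sum>l<h. form_sq B m b (\<lambda>i. D $$ (h + l, i))) =
    (\<Sum>k<B. \<Sum>i<m. (cmod (b i k))\<^sup>2)"
proof -
  have "(\<Sum>k<B. \<Sum>i<m. (cmod (b i k))\<^sup>2) =
      (\<Sum>k<B. \<Sum>n<length Ds. \<Sum>l<2 * h. (cmod (\<Sum>i<m. (Ds ! n) $$ (l, i) * b i k))\<^sup>2)"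
    by (simp add: kraus_complete_norm[OF assms, symmetric] sum_list_nth)
  also have "\<dots> = (\<Sum>n<length Ds. \<Sum>l<2 * h. form_sq B m b (\<lambda>i. (Ds ! n) $$ (l, i)))"
    unfolding form_sq_def by (subst sum.swap) (intro sum.cong refl sum.swap)
  finally show ?thesis by (simp add: sum_less_double sum_list_nth sum.distrib)
qed

text \<open>Let H be the mass decoded to 0. For b the decoder is right on both reference values,
  with equal masses, so the left-hand side is \<open>2 * H (b 0)\<close>, while
  \<open>H (b 1) = 0\<close>. For b' the mass H is the same at both reference values. Passing from
  \<open>b 0\<close> to \<open>b' 0\<close>, then to \<open>b' 1\<close>, then to
  \<open>b 1\<close>, each change between b and b' costs a factor 2 and a multiple of H of the
  difference: \<open>H (b 0) \<le> 2 * H (d 0) + 4 * H (d 1)\<close>.\<close>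

lemma alice_good_bob_good_separation:
  assumes Ds: "kraus_complete m (2 * h) Ds" and good: "alice_good B m h Ds b" "bob_good B m b'"
    and d: "\<And>r i k. r < 2 \<Longrightarrow> i < m \<Longrightarrow> k < B \<Longrightarrow> d r i k = b r i k - b' r i k"
  defines "N \<equiv> \<lambda>b. \<Sum>k<B. \<Sum>i<m. (cmod (b i k))\<^sup>2"
  shows "N (b 0) + N (b 1) \<le> 8 * (N (d 0) + N (d 1))"
proof -
  define H where "H = (\<lambda>b. \<Sum>D\<leftarrow>Ds. \<Sum>l<h. form_sq B m b (\<lambda>i. D $$ (l, i)))"
  define H' where "H' = (\<lambda>b. \<Sum>D\<leftarrow>Ds. \<Sum>l<h. form_sq B m b (\<lambda>i. D $$ (h + l, i)))"
  have N: "N b = H b + H' b" for b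
    unfolding N_def H_def H'_def by (rule kraus_complete_blocks[OF Ds, symmetric])
  have nonneg: "H b \<ge> 0" "H' b \<ge> 0" for b
    unfolding H_def H'_def by (intro sum_list_nonneg; force intro: sum_nonneg form_sq_nonneg)+
  have zero: "H' (b 0) = 0" "H (b 1) = 0" and eq: "H (b 0) = H' (b 1)"
    using good(1) unfolding H_def H'_def alice_good_def sum_list_nth by simp_all
  have eq': "H (b' 0) = H (b' 1)" using good(2) by (simp add: H_def bob_good_def)
  have add: "H c \<le> 2 * H c' + 2 * H e" if "\<And>i k. i < m \<Longrightarrow> k < B \<Longrightarrow> c i k = c' i k + e i k" for c c' e
    unfolding H_def sum_list_nth sum_distrib_left sum.distrib[symmetric]
    by (intro sum_mono form_sq_add_le that)
  have neg: "H (\<lambda>i k. - c i k) = H c" for c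
    by (simp add: H_def form_sq_def sum_negf)
  have "H (b 0) \<le> 2 * H (b' 0) + 2 * H (d 0)" by (rule add) (simp add: d)
  moreover have "H (b' 1) \<le> 2 * H (b 1) + 2 * H (\<lambda>i k. - d 1 i k)" by (rule add) (simp add: d)
  ultimately have "H (b 0) \<le> 4 * H (d 1) + 2 * H (d 0)" using zero(2) eq' neg[of "d 1"] by linarith
  then show ?thesis
    using nonneg[of "d 0"] nonneg[of "d 1"] unfolding N zero eq[symmetric] by simp
qed

section \<open>Amplitudes seen from Alice's side, and compression of Bob's system\<close>

lemma amp_norm:
  assumes "kraus_complete (2 * dA) m Ks" and "r < 2"
  shows "(\<Sum>K\<leftarrow>Ks. \<Sum>k<B. \<Sum>i<m. (cmod (amp dA K \<phi> r i k))\<^sup>2) = (\<Sum>\<alpha><dA. \<Sum>k<B. (cmod (\<phi> \<alpha> k))\<^sup>2)"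
proof -
  \<comment> \<open>\<open>z k\<close> is |r> tensored with column k of \<phi>; applying K to it
    gives \<open>amp\<close>, so the norm identity for complete Kraus families applies.\<close>
  define z where "z = (\<lambda>k j. if j div dA = r then \<phi> (j mod dA) k else 0)"
  have z: "z k (q * dA + \<alpha>) = (if q = r then \<phi> \<alpha> k else 0)" if "\<alpha> < dA" for k q \<alpha>
    using that by (auto simp: z_def)
  have "(\<Sum>j<2 * dA. K $$ (i, j) * z k j) = amp dA K \<phi> r i k" for K i k
  proof -
    have "(\<Sum>j<2 * dA. K $$ (i, j) * z k j) = (\<Sum>q<2. if q = r then amp dA K \<phi> r i k else 0)"
      unfolding sum_lessThan_mult amp_def by (intro sum.cong refl) (simp add: z)
    then show ?thesis using assms(2) by simp
  qed
  moreover have "(\<Sum>j<2 * dA. (cmod (z k j))\<^sup>2) = (\<Sum>\<alpha><dA. (cmod (\<phi> \<alpha> k))\<^sup>2)" for k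
  proof -
    have "(\<Sum>j<2 * dA. (cmod (z k j))\<^sup>2) = (\<Sum>q<2. if q = r then \<Sum>\<alpha><dA. (cmod (\<phi> \<alpha> k))\<^sup>2 else 0)"
      unfolding sum_lessThan_mult by (intro sum.cong refl) (simp add: z)
    then show ?thesis using assms(2) by simp
  qed
  ultimately have *: "(\<Sum>K\<leftarrow>Ks. \<Sum>i<m. (cmod (amp dA K \<phi> r i k))\<^sup>2) = (\<Sum>\<alpha><dA. (cmod (\<phi> \<alpha> k))\<^sup>2)" for k
    using kraus_complete_norm[OF assms(1), of "z k"] by simp
  have "(\<Sum>K\<leftarrow>Ks. \<Sum>k<B. \<Sum>i<m. (cmod (amp dA K \<phi> r i k))\<^sup>2) =
      (\<Sum>k<B. \<Sum>K\<leftarrow>Ks. \<Sum>i<m. (cmod (amp dA K \<phi> r i k))\<^sup>2)"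
    unfolding sum_list_nth by (rule sum.swap)
  also have "\<dots> = (\<Sum>\<alpha><dA. \<Sum>k<B. (cmod (\<phi> \<alpha> k))\<^sup>2)"
    unfolding * by (rule sum.swap)
  finally show ?thesis .
qed

text \<open>Alice's operator and c act on \<psi> first and leave a vector g on Bob's side,
  independent of his operator. What remains is the norm of L applied to g, which only depends on the
  Gram matrix of the columns of L.\<close>

lemma form_sq_amp_bob_image_cong:
  assumes "\<And>b b'. b < dB \<Longrightarrow> b' < dB \<Longrightarrow>
    (\<Sum>j<m'. L j b * cnj (L j b')) = (\<Sum>k<d. C k b * cnj (C k b'))"
  shows "form_sq m' m (amp dA K (bob_image dB \<psi> L) r) c = form_sq d m (amp dA K (bob_image dB \<psi> C) r) c"
proof -
  define g where "g = (\<lambda>\<beta>. \<Sum>i<m. \<Sum>\<alpha><dA. c i * (K $$ (i, r * dA + \<alpha>) * \<psi> $ (\<alpha> * dB + \<beta>)))"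
  have "(\<Sum>i<m. c i * amp dA K (bob_image dB \<psi> L) r i j) = (\<Sum>\<beta><dB. g \<beta> * L j \<beta>)" for L :: "nat \<Rightarrow> nat \<Rightarrow> complex" and j
  proof -
    have "(\<Sum>i<m. c i * amp dA K (bob_image dB \<psi> L) r i j) =
        (\<Sum>i<m. \<Sum>\<alpha><dA. \<Sum>\<beta><dB. c i * (K $$ (i, r * dA + \<alpha>) * \<psi> $ (\<alpha> * dB + \<beta>)) * L j \<beta>)"
      by (simp add: amp_def bob_image_def sum_distrib_left mult_ac)
    also have "\<dots> = (\<Sum>i<m. \<Sum>\<beta><dB. \<Sum>\<alpha><dA. c i * (K $$ (i, r * dA + \<alpha>) * \<psi> $ (\<alpha> * dB + \<beta>)) * L j \<beta>)"
      by (intro sum.cong refl sum.swap)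
    also have "\<dots> = (\<Sum>\<beta><dB. \<Sum>i<m. \<Sum>\<alpha><dA. c i * (K $$ (i, r * dA + \<alpha>) * \<psi> $ (\<alpha> * dB + \<beta>)) * L j \<beta>)"
      by (rule sum.swap)
    finally show ?thesis by (simp add: g_def sum_distrib_right)
  qed
  then show ?thesis
    unfolding form_sq_def
    using norm_sq_linear_comb_cong[where a = "\<lambda>b j. L j b" and b = "\<lambda>b k. C k b" and c = g
        and I = "{..<dB}" and J = "{..<m'}" and K = "{..<d}"] assms by simp
qed

lemma form_sq_amp_scale:
  "form_sq B m (amp dA K (\<lambda>\<alpha> k. s * \<phi> \<alpha> k) r) c = (cmod s)\<^sup>2 * form_sq B m (amp dA K \<phi> r) c"
proof -
  have "(\<Sum>i<m. c i * amp dA K (\<lambda>\<alpha> k. s * \<phi> \<alpha> k) r i k) = s * (\<Sum>i<m. c i * amp dA K \<phi> r i k)" for k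
    by (simp add: amp_def sum_distrib_left mult_ac)
  then show ?thesis
    by (simp only: form_sq_def norm_mult power_mult_distrib sum_distrib_left[symmetric])
qed

text \<open>Bob's post-measurement vector, compressed to \<open>\<complex>\<^sup>a \<otimes> \<complex>\<^sup>b\<close> (\<open>a = 2^qA\<close>, \<open>b = 2^qB\<close>) without changing
  its reduced state on Alice's side, and normalised.\<close>

lemma compressed_bob_vector:
  assumes \<psi>: "unit_vector (dA * dB) \<psi>" and Ls: "kraus_complete dB m' Ls"
  obtains L \<phi> s where "L \<in> set Ls" "(\<Sum>\<alpha><dA. \<Sum>k<dB. (cmod (\<phi> \<alpha> k))\<^sup>2) = 1"
    "\<And>m K r c. form_sq dB m (amp dA K \<phi> r) c =
      s * form_sq m' m (amp dA K (bob_image dB \<psi> (\<lambda>j \<beta>. L $$ (j, \<beta>))) r) c"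
proof -
  define w where "w = (\<lambda>L. bob_image dB \<psi> (\<lambda>j \<beta>. L $$ (j, \<beta>)))"
  have "\<psi> \<bullet>c \<psi> = (\<Sum>i<dA * dB. \<psi> $ i * cnj (\<psi> $ i))"
    using \<psi> by (auto simp: unit_vector_def scalar_prod_def lessThan_atLeast0)
  then have "complex_of_real (\<Sum>\<alpha><dA. \<Sum>\<beta><dB. (cmod (\<psi> $ (\<alpha> * dB + \<beta>)))\<^sup>2) = 1"
    using \<psi> unfolding unit_vector_def sum_lessThan_mult mult_cnj_self of_real_sum by simp
  then have norm: "(\<Sum>\<alpha><dA. \<Sum>\<beta><dB. (cmod (\<psi> $ (\<alpha> * dB + \<beta>)))\<^sup>2) = 1"
    by (simp only: of_real_eq_1_iff)
  have "(\<Sum>\<alpha><dA. \<Sum>L\<leftarrow>Ls. \<Sum>j<m'. (cmod (w L \<alpha> j))\<^sup>2) = 1"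
    unfolding w_def bob_image_def kraus_complete_norm[OF Ls] by (rule norm)
  then have total: "(\<Sum>L\<leftarrow>Ls. \<Sum>\<alpha><dA. \<Sum>j<m'. (cmod (w L \<alpha> j))\<^sup>2) = 1"
    unfolding sum_list_nth by (subst sum.swap)
  \<comment> \<open>The masses of Bob's branches add up to 1, so one is nonzero. The choice involves
    Bob's measurement alone and is the same for all inputs of Alice.\<close>
  have "\<exists>L\<in>set Ls. (\<Sum>\<alpha><dA. \<Sum>j<m'. (cmod (w L \<alpha> j))\<^sup>2) \<noteq> 0"
  proof (rule ccontr)
    assume "\<not> ?thesis"
    then have "(\<Sum>L\<leftarrow>Ls. \<Sum>\<alpha><dA. \<Sum>j<m'. (cmod (w L \<alpha> j))\<^sup>2) = 0"
      unfolding sum_list_nth by (intro sum.neutral) simp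
    with total show False by simp
  qed
  then obtain L where L: "L \<in> set Ls" and "(\<Sum>\<alpha><dA. \<Sum>j<m'. (cmod (w L \<alpha> j))\<^sup>2) \<noteq> 0" by blast
  define p where "p = (\<Sum>\<alpha><dA. \<Sum>j<m'. (cmod (w L \<alpha> j))\<^sup>2)"
  have "p \<ge> 0" unfolding p_def by (intro sum_nonneg) auto
  then have p: "p > 0" using \<open>_ \<noteq> 0\<close> by (simp add: p_def)
  obtain C where C: "\<And>b b'. b < dB \<Longrightarrow> b' < dB \<Longrightarrow>
      (\<Sum>j<m'. L $$ (j, b) * cnj (L $$ (j, b'))) = (\<Sum>k<dB. C k b * cnj (C k b'))"
    using square_matrix_same_gram[where L = "\<lambda>j b. L $$ (j, b)" and m = m' and d = dB] by blast
  \<comment> \<open>p is the squared norm of the chosen branch; the scaling makes \<phi> a unit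
    vector and multiplies every \<open>form_sq\<close> by \<open>1 / p\<close>.\<close>
  define \<phi> where "\<phi> = (\<lambda>\<alpha> k. of_real (1 / sqrt p) * bob_image dB \<psi> C \<alpha> k)"
  have "(\<Sum>j<m'. (cmod (w L \<alpha> j))\<^sup>2) = (\<Sum>k<dB. (cmod (bob_image dB \<psi> C \<alpha> k))\<^sup>2)" for \<alpha>
    unfolding w_def bob_image_def
    using norm_sq_linear_comb_cong[where a = "\<lambda>b j. L $$ (j, b)" and b = "\<lambda>b k. C k b"
        and c = "\<lambda>\<beta>. \<psi> $ (\<alpha> * dB + \<beta>)" and I = "{..<dB}" and J = "{..<m'}" and K = "{..<dB}"] C
    by (simp add: mult.commute)
  then have "(\<Sum>\<alpha><dA. \<Sum>k<dB. (cmod (bob_image dB \<psi> C \<alpha> k))\<^sup>2) = p"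
    by (simp add: p_def)
  then have 1: "(\<Sum>\<alpha><dA. \<Sum>k<dB. (cmod (\<phi> \<alpha> k))\<^sup>2) = 1"
    using p by (simp add: \<phi>_def norm_mult norm_divide power_mult_distrib power_divide flip: sum_divide_distrib)
  have "form_sq m' m (amp dA K (w L) r) c = form_sq dB m (amp dA K (bob_image dB \<psi> C) r) c" for m K r c
    unfolding w_def by (rule form_sq_amp_bob_image_cong) (rule C)
  then have "form_sq dB m (amp dA K \<phi> r) c = (1 / p) * form_sq m' m (amp dA K (w L) r) c" for m K r c
    unfolding \<phi>_def form_sq_amp_scale using p by (simp add: norm_divide power_divide)
  then show thesis using that[OF L 1] unfolding w_def by blast
qed

section \<open>From a perfect attack to separated vectors, and the final count\<close>

lemma in_set_concatE:
  assumes "x \<in> set (concat xss)"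
  obtains n where "n < length xss" "x \<in> set (xss ! n)"
  using assms by (metis UN_E in_set_conv_nth set_concat)

text \<open>The equations of \<open>final_amplitudes\<close> hold for all Kraus operators of both
  decoders, so injectivity removes one of them. Removing Bob's gives equations between vectors on
  his system, whose norms are those in \<open>alice_good\<close>. Removing Alice's leaves Bob's
  outputs for the two reference values equal up to the flip of his output qubit, hence of equal
  norm.\<close>

lemma good_from_perfect:
  assumes valid: "valid_attack n P" and perfect: "perfect_attack n f P"
    and x: "x \<in> bitstrings n" and y: "y \<in> bitstrings n" and st: "(s, t) \<in> outcomes P x y"
    and K: "K \<in> set (measA P x ! s)" and L: "L \<in> set (measB P y ! t)"
  defines "a \<equiv> amp (2 ^ qA P) K (bob_image (2 ^ qB P) (shared P) (\<lambda>j \<beta>. L $$ (j, \<beta>)))"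
  shows "\<not> f x y \<Longrightarrow> alice_good (dimB P) (dimA P) (restA P) (finalA P x s (msgB P y t)) a"
    and "f x y \<Longrightarrow> bob_good (dimB P) (dimA P) a"
proof -
  let ?Ds = "finalA P x s (msgB P y t)" and ?Es = "finalB P y t (msgA P x s)"
  have Ds: "kraus_complete (dimA P) (2 * restA P) ?Ds" and Es: "kraus_complete (dimB P) (2 * restB P) ?Es"
    using valid[unfolded valid_attack_def, THEN conjunct2, THEN conjunct2, THEN conjunct2,
      rule_format, OF x y st] by simp_all
  note amps = final_amplitudes[OF valid perfect x y st K L, folded a_def]
  show "alice_good (dimB P) (dimA P) (restA P) ?Ds a" if "\<not> f x y"
    unfolding alice_good_def
  proof (intro ballI allI impI)
    fix D l assume D: "D \<in> set ?Ds" and l: "l < restA P"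
    define z where "z = (\<lambda>r i j. \<Sum>i'<dimA P. D $$ (i, i') * a r i' j)"
    have eq: "(\<Sum>i'<dimA P. \<Sum>j'<dimB P. D $$ (i, i') * E $$ (j, j') * a r i' j') =
        (\<Sum>j'<dimB P. E $$ (j, j') * z r i j')" for E r i j
      unfolding z_def sum_distrib_left by (subst sum.swap) (intro sum.cong refl, simp only: mult_ac)
    note W = amps(1)[OF D _ that l, unfolded eq]
    \<comment> \<open>The amplitudes are Bob's Kraus operators applied to z, so z itself must
      vanish.\<close>
    have "z 0 (restA P + l) j = 0" if "j < dimB P" for j
      by (rule kraus_complete_zero[OF Es _ that]) (use W in simp)
    moreover have "z 1 l j = 0" if "j < dimB P" for j
      by (rule kraus_complete_zero[OF Es _ that]) (use W in simp)
    moreover have "z 0 l j - z 1 (restA P + l) j = 0" if "j < dimB P" for j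
      by (rule kraus_complete_zero[OF Es _ that]) (use W in \<open>simp add: right_diff_distrib sum_subtractf\<close>)
    ultimately show "form_sq (dimB P) (dimA P) (a 0) (\<lambda>i. D $$ (restA P + l, i)) = 0 \<and>
        form_sq (dimB P) (dimA P) (a 1) (\<lambda>i. D $$ (l, i)) = 0 \<and>
        form_sq (dimB P) (dimA P) (a 0) (\<lambda>i. D $$ (l, i)) =
        form_sq (dimB P) (dimA P) (a 1) (\<lambda>i. D $$ (restA P + l, i))"
      unfolding form_sq_def z_def by simp
  qed
  show "bob_good (dimB P) (dimA P) a" if "f x y"
    unfolding bob_good_def
  proof
    fix c
    define z where "z = (\<lambda>E r j i. \<Sum>j'<dimB P. E $$ (j, j') * a r i j')"
    have z: "z E 0 (restB P + l) i = 0 \<and> z E 1 l i = 0 \<and> z E 0 l i = z E 1 (restB P + l) i"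
      if E: "E \<in> set ?Es" and l: "l < restB P" and i: "i < dimA P" for E l i
    proof -
      have eq: "(\<Sum>i'<dimA P. \<Sum>j'<dimB P. D $$ (i, i') * E $$ (j, j') * a r i' j') =
          (\<Sum>i'<dimA P. D $$ (i, i') * z E r j i')" for D r i j
        unfolding z_def sum_distrib_left by (simp add: mult_ac)
      note W = amps(2)[OF _ E \<open>f x y\<close> _ l, unfolded eq]
      have "z E 0 (restB P + l) i = 0"
        by (rule kraus_complete_zero[OF Ds _ i]) (use W in simp)
      moreover have "z E 1 l i = 0"
        by (rule kraus_complete_zero[OF Ds _ i]) (use W in simp)
      moreover have "z E 0 l i - z E 1 (restB P + l) i = 0"
        by (rule kraus_complete_zero[OF Ds _ i]) (use W in \<open>simp add: right_diff_distrib sum_subtractf\<close>)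
      ultimately show ?thesis by simp
    qed
    define Z where "Z = (\<lambda>E r j. \<Sum>i<dimA P. c i * z E r j i)"
    \<comment> \<open>Bob's decoder preserves norms, so the form can be evaluated after it,
      separately for his two output qubit values.\<close>
    have form: "form_sq (dimB P) (dimA P) (a r) c =
        (\<Sum>E\<leftarrow>?Es. (\<Sum>l<restB P. (cmod (Z E r l))\<^sup>2) + (\<Sum>l<restB P. (cmod (Z E r (restB P + l)))\<^sup>2))" for r
    proof -
      have "(\<Sum>j'<dimB P. E $$ (j, j') * (\<Sum>i<dimA P. c i * a r i j')) = Z E r j" for E j
        unfolding Z_def z_def sum_distrib_left by (subst sum.swap) (simp add: mult_ac)
      then show ?thesis
        unfolding form_sq_def kraus_complete_norm[OF Es, symmetric] sum_less_double by simp
    qed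
    have Z: "Z E 0 (restB P + l) = 0" "Z E 1 l = 0" "Z E 0 l = Z E 1 (restB P + l)"
      if "E \<in> set ?Es" "l < restB P" for E l
      using z[OF that] by (simp_all add: Z_def)
    show "form_sq (dimB P) (dimA P) (a 0) c = form_sq (dimB P) (dimA P) (a 1) c"
      unfolding form by (intro arg_cong[where f = sum_list] map_cong refl) (simp add: Z Z(2)[unfolded One_nat_def])
  qed
qed

text \<open>For each Kraus operator of Alice on x, the decoder she uses against y is also tested on
  the vector of y'. This is legitimate although her decoder there may differ, since
  \<open>bob_good\<close> covers every c. Summing over her Kraus operators turns the amplitudes back
  into norms of \<phi> and of the difference.\<close>

lemma separated_vectors:
  assumes valid: "valid_attack n P" and perfect: "perfect_attack n f P"
    and x: "x \<in> bitstrings n" and y: "y \<in> bitstrings n" "y' \<in> bitstrings n"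
    and f: "\<not> f x y" "f x y'"
    and L: "L \<in> set (concat (measB P y))" "L' \<in> set (concat (measB P y'))"
    and form: "\<And>m K r c. form_sq (2 ^ qB P) m (amp (2 ^ qA P) K \<phi> r) c = u *
      form_sq (dimB P) m (amp (2 ^ qA P) K (bob_image (2 ^ qB P) (shared P) (\<lambda>j \<beta>. L $$ (j, \<beta>))) r) c"
    and form': "\<And>m K r c. form_sq (2 ^ qB P) m (amp (2 ^ qA P) K \<phi>' r) c = u' *
      form_sq (dimB P) m (amp (2 ^ qA P) K (bob_image (2 ^ qB P) (shared P) (\<lambda>j \<beta>. L' $$ (j, \<beta>))) r) c"
  shows "(\<Sum>\<alpha><2 ^ qA P. \<Sum>k<2 ^ qB P. (cmod (\<phi> \<alpha> k))\<^sup>2) \<le>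
    8 * (\<Sum>\<alpha><2 ^ qA P. \<Sum>k<2 ^ qB P. (cmod (\<phi> \<alpha> k - \<phi>' \<alpha> k))\<^sup>2)"
proof -
  define dA dB where "dA = (2::nat) ^ qA P" and "dB = (2::nat) ^ qB P"
  define N where "N = (\<lambda>K \<phi> r. \<Sum>k<dB. \<Sum>i<dimA P. (cmod (amp dA K \<phi> r i k))\<^sup>2)"
  define d where "d = (\<lambda>\<alpha> k. \<phi> \<alpha> k - \<phi>' \<alpha> k)"
  have Ks: "kraus_complete (2 * dA) (dimA P) (concat (measA P x))"
    using valid x by (auto simp: valid_attack_def instrument_def dA_def)
  obtain t where t: "t < length (measB P y)" "L \<in> set (measB P y ! t)"
    using L(1) by (rule in_set_concatE)
  obtain t' where t': "t' < length (measB P y')" "L' \<in> set (measB P y' ! t')"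
    using L(2) by (rule in_set_concatE)
  have "N K \<phi> 0 + N K \<phi> 1 \<le> 8 * (N K d 0 + N K d 1)" if K: "K \<in> set (concat (measA P x))" for K
  proof -
    obtain s where s: "s < length (measA P x)" "K \<in> set (measA P x ! s)"
      using K by (rule in_set_concatE)
    have st: "(s, t) \<in> outcomes P x y" "(s, t') \<in> outcomes P x y'"
      using s t t' by (auto simp: outcomes_def)
    \<comment> \<open>Both conditions are homogeneous in \<open>form_sq\<close>, so the common
      factor u (or u') and the compression preserve them.\<close>
    have "alice_good dB (dimA P) (restA P) (finalA P x s (msgB P y t)) (amp dA K \<phi>)"
      using good_from_perfect(1)[OF valid perfect x y(1) st(1) s(2) t(2) f(1)]
      unfolding alice_good_def dA_def dB_def form by simp
    moreover have "bob_good dB (dimA P) (amp dA K \<phi>')"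
      using good_from_perfect(2)[OF valid perfect x y(2) st(2) s(2) t'(2) f(2)]
      unfolding bob_good_def dA_def dB_def form' by simp
    moreover have "kraus_complete (dimA P) (2 * restA P) (finalA P x s (msgB P y t))"
      using valid[unfolded valid_attack_def, THEN conjunct2, THEN conjunct2, THEN conjunct2,
        rule_format, OF x y(1) st(1)] by simp
    moreover have "amp dA K d r i k = amp dA K \<phi> r i k - amp dA K \<phi>' r i k" for r i k
      by (simp add: amp_def d_def right_diff_distrib sum_subtractf)
    ultimately show ?thesis
      unfolding N_def by (intro alice_good_bob_good_separation)
  qed
  then have "(\<Sum>K\<leftarrow>concat (measA P x). N K \<phi> 0 + N K \<phi> 1) \<le>
      (\<Sum>K\<leftarrow>concat (measA P x). 8 * (N K d 0 + N K d 1))"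
    by (rule sum_list_mono)
  \<comment> \<open>By \<open>amp_norm\<close>, each of the two reference values contributes the
    full norm, whence the factor 2 on both sides.\<close>
  then have "2 * (\<Sum>\<alpha><dA. \<Sum>k<dB. (cmod (\<phi> \<alpha> k))\<^sup>2) \<le> 8 * (2 * (\<Sum>\<alpha><dA. \<Sum>k<dB. (cmod (d \<alpha> k))\<^sup>2))"
    unfolding sum_list_const_mult sum_list_addf N_def by (simp add: amp_norm[OF Ks])
  then show ?thesis by (simp add: d_def dA_def dB_def)
qed

lemma card_bitstrings: "card (bitstrings n) = 2 ^ n"
  using card_lists_length_eq[of "UNIV :: bool set" n] by (simp add: bitstrings_def)

theorem theorem4p14:
  shows "\<exists>c>0::real. \<forall>n\<ge>1::nat. \<forall>(f :: bool list \<Rightarrow> bool list \<Rightarrow> bool) (P :: attack).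
    injective_for_Bob n f \<longrightarrow> valid_attack n P \<longrightarrow> perfect_attack n f P \<longrightarrow>
    2 ^ (qA P + qB P) \<ge> c * real n"
proof (intro exI[of _ "1 / 24"] conjI allI impI)
  fix n f P
  assume inj: "injective_for_Bob n f" and valid: "valid_attack n P" and perfect: "perfect_attack n f P"
  define dA dB where "dA = (2::nat) ^ qA P" and "dB = (2::nat) ^ qB P"
  \<comment> \<open>Packages what \<open>compressed_bob_vector\<close> provides, so that one \<phi>
    can be chosen for each y before any x is considered.\<close>
  define rep where "rep = (\<lambda>y \<phi>. (\<Sum>\<alpha><dA. \<Sum>k<dB. (cmod (\<phi> \<alpha> k))\<^sup>2) = 1 \<and>
    (\<exists>L\<in>set (concat (measB P y)). \<exists>u. \<forall>m K r c. form_sq dB m (amp dA K \<phi> r) c = u *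
      form_sq (dimB P) m (amp dA K (bob_image dB (shared P) (\<lambda>j \<beta>. L $$ (j, \<beta>))) r) c))"
  have "\<exists>\<phi>. rep y \<phi>" if "y \<in> bitstrings n" for y
  proof -
    have "unit_vector (dA * dB) (shared P)" "kraus_complete dB (dimB P) (concat (measB P y))"
      using valid that by (auto simp: valid_attack_def instrument_def dA_def dB_def)
    from compressed_bob_vector[OF this] show ?thesis unfolding rep_def by metis
  qed
  then obtain \<phi> where \<phi>: "rep y (\<phi> y)" if "y \<in> bitstrings n" for y by metis
  have sep_aux: "(\<Sum>\<alpha><dA. \<Sum>k<dB. (cmod (\<phi> y \<alpha> k - \<phi> y' \<alpha> k))\<^sup>2) \<ge> 1 / 8"
    if x: "x \<in> bitstrings n" and y: "y \<in> bitstrings n" "y' \<in> bitstrings n" and f: "\<not> f x y" "f x y'" for x y y'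
  proof -
    from \<phi>[OF y(1)] obtain L u where L: "L \<in> set (concat (measB P y))" and
      form: "\<And>m K r c. form_sq dB m (amp dA K (\<phi> y) r) c = u *
        form_sq (dimB P) m (amp dA K (bob_image dB (shared P) (\<lambda>j \<beta>. L $$ (j, \<beta>))) r) c"
      unfolding rep_def by blast
    from \<phi>[OF y(2)] obtain L' u' where L': "L' \<in> set (concat (measB P y'))" and
      form': "\<And>m K r c. form_sq dB m (amp dA K (\<phi> y') r) c = u' *
        form_sq (dimB P) m (amp dA K (bob_image dB (shared P) (\<lambda>j \<beta>. L' $$ (j, \<beta>))) r) c"
      unfolding rep_def by blast
    show ?thesis
      using separated_vectors[OF valid perfect x y f L L' form[unfolded dA_def dB_def] form'[unfolded dA_def dB_def]]
        \<phi>[OF y(1)] by (simp add: rep_def dA_def dB_def)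
  qed
  have sep: "(\<Sum>\<alpha><dA. \<Sum>k<dB. (cmod (\<phi> y \<alpha> k - \<phi> y' \<alpha> k))\<^sup>2) \<ge> 1 / 8"
    if y: "y \<in> bitstrings n" "y' \<in> bitstrings n" "y \<noteq> y'" for y y'
  proof -
    obtain x where x: "x \<in> bitstrings n" and "f x y \<noteq> f x y'"
      using inj y by (auto simp: injective_for_Bob_def)
    \<comment> \<open>Injectivity does not say which of the two values is 0; the distance is
      symmetric, so the roles of y and y' may be exchanged.\<close>
    then consider "\<not> f x y" "f x y'" | "\<not> f x y'" "f x y" by auto
    then show ?thesis
      using sep_aux[OF x y(1,2)] sep_aux[OF x y(2,1)] by cases (simp_all add: norm_minus_commute)
  qed
  have dm: "(\<alpha> * dB + k) div dB = \<alpha>" "(\<alpha> * dB + k) mod dB = k" if "k < dB" for \<alpha> k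
    using that by auto
  have "card (bitstrings n) \<le> 2 ^ (24 * (dA * dB))"
    using \<phi> sep
    by (intro card_separated_complex_le[where v = "\<lambda>y i. \<phi> y (i div dB) (i mod dB)"])
      (simp_all add: sum_lessThan_mult dm rep_def)
  \<comment> \<open>Comparing exponents in \<open>2 ^ n \<le> 2 ^ (24 * (dA * dB))\<close>. The 24
    is 12 per real coordinate, with two real coordinates per complex one, and yields the constant
    1/24.\<close>
  then have "n \<le> 24 * (dA * dB)"
    by (simp add: card_bitstrings)
  then have "real n \<le> 24 * real (dA * dB)" by linarith
  then show "1 / 24 * real n \<le> 2 ^ (qA P + qB P)"
    by (simp add: dA_def dB_def power_add)
qed simp

end
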